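(* Let $(A_h,\widehat H_h)$ be a solution of the hybrid method: for all times, $$\int_K\bigl(A_h'\cdot(\dot D_h+J)-\operatorname{curl}A_h'\cdot H_h\bigr)+\int_{\partial K}(A_h'\times\widehat H_h)\cdot\mathbf{n}=0\quad\forall A_h'\in V_h^1(K),\ \forall K\in\mathcal{T}_h,$$ $$\sum_{K\in\mathcal{T}_h}\int_{\partial K}(A_h\times\widehat H_h')\cdot\mathbf{n}=0\quad\forall\widehat H_h'\in\widehat V_h^1 .$$ Suppose that the initial values of $D_h$ and of $\widehat D_h$ (the latter in $H(\operatorname{div};\Omega)$) satisfy, for all $K\in\mathcal{T}_h$, $$\int_K(\operatorname{grad}\varphi_h'\cdot D_h+\varphi_h'\rho)-\int_{\partial K}\varphi_h'\,\widehat D_h\cdot\mathbf{n}=0\quad\forall\varphi_h'\in V_h^0(K),\qquad(\ast)$$ and let $\widehat D_h$ be the solution, with this initial value, of $\dot{\widehat D}_h+J=\operatorname{curl}\widehat H_h$. Then $(\ast)$ holds for all $K\in\mathcal{T}_h$ and for all time. In particular, $\int_{\partial K}\widehat D_h\cdot\mathbf{n}=\int_K\rho$ for all $K\in\mathcal{T}_h$ (and all time). Moreover, if $\operatorname{div}\widehat D_h=\rho$ holds at the initial time, then it holds for all time.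
   Context: Setting. $\Omega\subset\mathbb{R}^3$ is a bounded polyhedral Lipschitz domain with a triangulation $\mathcal{T}_h$ by tetrahedra $K$; $\mathbf{n}$ denotes outer unit normals. $H^1$, $H(\operatorname{curl})$, $H(\operatorname{div})$ are the usual spaces of $L^2$ functions/fields with $L^2$ gradient, curl, divergence, and $H(\operatorname{curl};\mathcal{T}_h)$ is the space of $L^2$ fields whose restriction to each $K\in\mathcal{T}_h$ is in $H(\operatorname{curl};K)$. Time $t$ ranges over an interval containing an initial time, and a dot denotes $\partial_t$. The tensors $\epsilon=\epsilon_{ij}(x,t)$ and $\mu=\mu_{ij}(x,t)$ are $L^\infty$, symmetric and uniformly elliptic. The current density $J$ is a given $C^0$ curve in $H(\operatorname{div};\Omega)$ and the charge density $\rho$ is a given $C^1$ curve in $L^2(\Omega)$, with $\dot\rho+\operatorname{div}J=0$. Discrete spaces. For each $K$, $V_h^1(K)\subset H(\operatorname{curl};K)$ is a finite-dimensional subspace, and $V_h^1=\prod_{K\in\mathcal{T}_h}V_h^1(K)\subset H(\operatorname{curl};\mathcal{T}_h)$; $\widehat V_h^1\subset H(\operatorname{curl};\Omega)$ is a subspace (not necessarily finite-dimensional). For each $K$, $V_h^0(K)\subset H^1(K)$ is a subspace with $\mathbf{1}_K\in V_h^0(K)$ (the constant function $1$ on $K$) and $\operatorname{grad}V_h^0(K)\subset V_h^1(K)$. Unknowns: $A_h$ is a $C^1$ curve in $V_h^1$ and $\widehat H_h$ is a $C^0$ curve in $\widehat V_h^1$ (with the $H(\operatorname{curl};\Omega)$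 norm). With curl taken elementwise, $E_h=-\dot A_h$, $B_h=\operatorname{curl}A_h$, $D_h=\epsilon E_h$, $H_h=\mu^{-1}B_h$, and $D_h$ is a $C^1$ curve in $L^2(\Omega,\mathbb{R}^3)$. Boundary integrals are in the trace (duality) sense: $\int_{\partial K}(u\times v)\cdot\mathbf{n}=\int_K(\operatorname{curl}u\cdot v-u\cdot\operatorname{curl}v)$ for $u,v\in H(\operatorname{curl};K)$, and $\int_{\partial K}\psi\,w\cdot\mathbf{n}=\int_K(\operatorname{grad}\psi\cdot w+\psi\operatorname{div}w)$ for $\psi\in H^1(K)$, $w\in H(\operatorname{div};K)$. *)

theory Defs
  imports "HOL-Analysis.Analysis"
begin

section \<open>The Hilbert spaces of square integrable functions on three-space\<close>

type_synonym point = "real^3"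

definition square_integrable :: "(point \<Rightarrow> 'b::euclidean_space) \<Rightarrow> bool" where
  "square_integrable f \<longleftrightarrow>
     f \<in> borel_measurable lebesgue \<and> integrable lebesgue (\<lambda>x. (norm (f x))\<^sup>2)"

definition L2_eq :: "(point \<Rightarrow> 'b::euclidean_space) \<Rightarrow> (point \<Rightarrow> 'b) \<Rightarrow> bool" where
  "L2_eq f g \<longleftrightarrow> square_integrable f \<and> square_integrable g \<and> (AE x in lebesgue. f x = g x)"

lemma square_integrable_zero: "square_integrable (\<lambda>x. 0)"
  by (simp add: square_integrable_def)

lemma square_integrable_add:
  assumes "square_integrable f" "square_integrable g"
  shows "square_integrable (\<lambda>x. f x + g x)"
proof -
  have m: "f \<in> borel_measurable lebesgue" "g \<in> borel_measurable lebesgue"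
    using assms by (auto simp: square_integrable_def)
  have "integrable lebesgue (\<lambda>x. (norm (f x + g x))\<^sup>2)"
  proof (rule Bochner_Integration.integrable_bound)
    show "integrable lebesgue (\<lambda>x. 2 * (norm (f x))\<^sup>2 + 2 * (norm (g x))\<^sup>2)"
      using assms by (auto simp: square_integrable_def)
    show "(\<lambda>x. (norm (f x + g x))\<^sup>2) \<in> borel_measurable lebesgue"
      using m by measurable
    have "(norm (a + b))\<^sup>2 \<le> 2 * (norm a)\<^sup>2 + 2 * (norm b)\<^sup>2" for a b :: 'a
    proof -
      have "(norm (a + b))\<^sup>2 \<le> (norm a + norm b)\<^sup>2"
        by (simp add: norm_triangle_ineq power_mono)
      also have "\<dots> \<le> 2 * (norm a)\<^sup>2 + 2 * (norm b)\<^sup>2"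
        using zero_le_power2[of "norm a - norm b"] by (simp add: power2_eq_square algebra_simps)
      finally show ?thesis .
    qed
    then show "AE x in lebesgue. norm ((norm (f x + g x))\<^sup>2)
        \<le> norm (2 * (norm (f x))\<^sup>2 + 2 * (norm (g x))\<^sup>2)"
      by (simp add: abs_of_nonneg)
  qed
  then show ?thesis using m by (auto simp: square_integrable_def)
qed

lemma square_integrable_scaleR:
  assumes "square_integrable f"
  shows "square_integrable (\<lambda>x. c *\<^sub>R f x)"
  using assms by (auto simp: square_integrable_def power_mult_distrib)

lemma square_integrable_inner:
  assumes "square_integrable f" "square_integrable g"
  shows "integrable lebesgue (\<lambda>x. f x \<bullet> g x)"
proof (rule Bochner_Integration.integrable_bound)
  have m: "f \<in> borel_measurable lebesgue" "g \<in> borel_measurable lebesgue"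
    using assms by (auto simp: square_integrable_def)
  show "integrable lebesgue (\<lambda>x. (norm (f x))\<^sup>2 + (norm (g x))\<^sup>2)"
    using assms by (auto simp: square_integrable_def)
  show "(\<lambda>x. f x \<bullet> g x) \<in> borel_measurable lebesgue"
    using m by measurable
  have "\<bar>a \<bullet> b\<bar> \<le> (norm a)\<^sup>2 + (norm b)\<^sup>2" for a b :: 'a
  proof -
    have "\<bar>a \<bullet> b\<bar> \<le> norm a * norm b" by (rule Cauchy_Schwarz_ineq2)
    also have "\<dots> \<le> (norm a)\<^sup>2 + (norm b)\<^sup>2"
      using zero_le_power2[of "norm a - norm b"] mult_nonneg_nonneg[of "norm a" "norm b"]
      by (simp add: power2_eq_square algebra_simps del: mult_nonneg_nonneg)
    finally show ?thesis .
  qed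
  then show "AE x in lebesgue. norm (f x \<bullet> g x) \<le> norm ((norm (f x))\<^sup>2 + (norm (g x))\<^sup>2)"
    by (simp add: abs_of_nonneg)
qed

quotient_type (overloaded) 'b L2 = "point \<Rightarrow> ('b::euclidean_space)" / partial: L2_eq
  morphisms rep_L2 abs_L2
proof (rule part_equivpI)
  show "\<exists>f::point \<Rightarrow> 'b. L2_eq f f"
    by (rule exI[of _ "\<lambda>x. 0"]) (simp add: L2_eq_def square_integrable_zero)
  show "symp (L2_eq :: (point \<Rightarrow> 'b) \<Rightarrow> _)"
    by (rule sympI) (auto simp: L2_eq_def elim: AE_mp)
  show "transp (L2_eq :: (point \<Rightarrow> 'b) \<Rightarrow> _)"
    by (rule transpI) (auto simp: L2_eq_def elim: AE_mp)
qed

instantiation L2 :: (euclidean_space) real_inner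
begin

lift_definition zero_L2 :: "'a L2" is "\<lambda>x. 0"
  by (simp add: L2_eq_def square_integrable_zero)

lift_definition plus_L2 :: "'a L2 \<Rightarrow> 'a L2 \<Rightarrow> 'a L2" is "\<lambda>f g x. f x + g x"
  by (auto simp: L2_eq_def square_integrable_add elim: AE_mp)

lift_definition scaleR_L2 :: "real \<Rightarrow> 'a L2 \<Rightarrow> 'a L2" is "\<lambda>c f x. c *\<^sub>R f x"
  by (auto simp: L2_eq_def square_integrable_scaleR elim: AE_mp)

definition uminus_L2 :: "'a L2 \<Rightarrow> 'a L2" where "- u = (-1) *\<^sub>R u" for u :: "'a L2"

definition minus_L2 :: "'a L2 \<Rightarrow> 'a L2 \<Rightarrow> 'a L2" where "u - v = u + - v" for u v :: "'a L2"

lift_definition inner_L2 :: "'a L2 \<Rightarrow> 'a L2 \<Rightarrow> real" is "\<lambda>f g. LINT x|lebesgue. f x \<bullet> g x"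
proof -
  fix f f' g g' :: "point \<Rightarrow> 'a"
  assume A: "L2_eq f f'" "L2_eq g g'"
  have "f \<in> borel_measurable lebesgue" "g \<in> borel_measurable lebesgue"
    "f' \<in> borel_measurable lebesgue" "g' \<in> borel_measurable lebesgue"
    using A by (auto simp: L2_eq_def square_integrable_def)
  moreover have "AE x in lebesgue. f x \<bullet> g x = f' x \<bullet> g' x"
    using A by (auto simp: L2_eq_def elim: AE_mp)
  ultimately show "(LINT x|lebesgue. f x \<bullet> g x) = (LINT x|lebesgue. f' x \<bullet> g' x)"
    by (intro integral_cong_AE) auto
qed

definition norm_L2 :: "'a L2 \<Rightarrow> real" where "norm u = sqrt (u \<bullet> u)" for u :: "'a L2"
definition sgn_L2 :: "'a L2 \<Rightarrow> 'a L2" where "sgn u = inverse (norm u) *\<^sub>R u" for u :: "'a L2"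
definition dist_L2 :: "'a L2 \<Rightarrow> 'a L2 \<Rightarrow> real" where "dist u v = norm (u - v)" for u v :: "'a L2"
definition uniformity_L2 :: "('a L2 \<times> 'a L2) filter" where
  "uniformity = (INF e\<in>{0<..}. principal {(u, v::'a L2). dist u v < e})"
definition open_L2 :: "'a L2 set \<Rightarrow> bool" where
  "open U = (\<forall>u\<in>U. \<forall>\<^sub>F (u', v) in uniformity. u' = u \<longrightarrow> v \<in> U)" for U :: "'a L2 set"

instance
proof
  fix u v w :: "'a L2" and a b :: real
  show "u + v + w = u + (v + w)"
    by transfer (auto simp: L2_eq_def add.assoc square_integrable_add)
  show "u + v = v + u"
    by transfer (auto simp: L2_eq_def add.commute square_integrable_add)
  show "0 + u = u"
    by transfer (auto simp: L2_eq_def)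
  show "- u + u = 0"
    unfolding uminus_L2_def
    by transfer (auto simp: L2_eq_def square_integrable_zero)
  show "u - v = u + - v" by (simp add: minus_L2_def)
  show "a *\<^sub>R (u + v) = a *\<^sub>R u + a *\<^sub>R v"
    by transfer (auto simp: L2_eq_def scaleR_add_right square_integrable_scaleR square_integrable_add)
  show "(a + b) *\<^sub>R u = a *\<^sub>R u + b *\<^sub>R u"
    by transfer (auto simp: L2_eq_def scaleR_add_left square_integrable_scaleR square_integrable_add)
  show "a *\<^sub>R b *\<^sub>R u = (a * b) *\<^sub>R u"
    by transfer (auto simp: L2_eq_def square_integrable_scaleR)
  show "1 *\<^sub>R u = u"
    by transfer (auto simp: L2_eq_def)
  show "dist u v = norm (u - v)" by (rule dist_L2_def)
  show "sgn u = inverse (norm u) *\<^sub>R u" by (rule sgn_L2_def)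
  show "(uniformity :: ('a L2 \<times> 'a L2) filter) = (INF e\<in>{0<..}. principal {(u, v). dist u v < e})"
    by (rule uniformity_L2_def)
  show "open U = (\<forall>u\<in>U. \<forall>\<^sub>F (u', v) in uniformity. u' = u \<longrightarrow> v \<in> U)" for U :: "'a L2 set"
    by (rule open_L2_def)
  show "u \<bullet> v = v \<bullet> u"
    by transfer (simp add: inner_commute)
  show "(u + v) \<bullet> w = u \<bullet> w + v \<bullet> w"
    by transfer (auto simp: L2_eq_def inner_add_left square_integrable_inner)
  show "a *\<^sub>R u \<bullet> v = a * (u \<bullet> v)"
    by transfer (auto simp: L2_eq_def)
  show "0 \<le> u \<bullet> u"
    by transfer simp
  show "(u \<bullet> u = 0) = (u = 0)"
  proof transfer
    fix f :: "point \<Rightarrow> 'a"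
    assume "L2_eq f f"
    then have f: "square_integrable f" by (simp add: L2_eq_def)
    have "(LINT x|lebesgue. f x \<bullet> f x) = 0 \<longleftrightarrow> (AE x in lebesgue. f x \<bullet> f x = 0)"
      using square_integrable_inner[OF f f]
      by (intro integral_nonneg_eq_0_iff_AE) auto
    then show "(LINT x|lebesgue. f x \<bullet> f x) = 0 \<longleftrightarrow> L2_eq f (\<lambda>x. 0)"
      using f by (simp add: L2_eq_def square_integrable_zero)
  qed
  show "norm u = sqrt (u \<bullet> u)" by (rule norm_L2_def)
qed

end

text \<open>
  Functions on a measurable set \<open>S\<close> are identified with their extensions by zero, so the
  \<open>L\<^sup>2\<close>-space over \<open>S\<close> is a closed subspace of \<^typ>\<open>'b L2\<close>.
\<close>

definition L2_on :: "point set \<Rightarrow> 'b::euclidean_space L2 set" where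
  "L2_on S = {u. AE x in lebesgue. x \<notin> S \<longrightarrow> rep_L2 u x = 0}"

text \<open>
  \<open>abs_L2 f\<close> is the class of \<open>f\<close> only for square integrable \<open>f\<close>. This holds below if \<open>S\<close> is
  measurable (for \<open>one_on\<close>: of finite measure), and for \<open>mult_field\<close> if \<open>\<epsilon>\<close> is measurable and
  bounded a.e. on a set outside of which \<open>u\<close> vanishes a.e.
\<close>

definition restr :: "point set \<Rightarrow> 'b::euclidean_space L2 \<Rightarrow> 'b L2" where
  "restr S u = abs_L2 (\<lambda>x. indicator S x *\<^sub>R rep_L2 u x)"

definition one_on :: "point set \<Rightarrow> real L2" where
  "one_on S = abs_L2 (indicator S)"

definition mult_field :: "(point \<Rightarrow> real^3^3) \<Rightarrow> (real^3) L2 \<Rightarrow> (real^3) L2" where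
  "mult_field \<epsilon> u = abs_L2 (\<lambda>x. \<epsilon> x *v rep_L2 u x)"

definition int_on :: "point set \<Rightarrow> real L2 \<Rightarrow> real" where
  "int_on S f = (LINT x:S|lebesgue. rep_L2 f x)"

definition ip :: "point set \<Rightarrow> 'b::euclidean_space L2 \<Rightarrow> 'b L2 \<Rightarrow> real" where
  "ip S u v = (LINT x:S|lebesgue. rep_L2 u x \<bullet> rep_L2 v x)"


section \<open>Test functions and weak differential operators\<close>

definition partial :: "3 \<Rightarrow> (point \<Rightarrow> real) \<Rightarrow> point \<Rightarrow> real" where
  "partial i f x = frechet_derivative f (at x) (axis i 1)"

text \<open>Infinite differentiability: all iterated partial derivatives are differentiable everywhere.\<close>

definition smooth :: "(point \<Rightarrow> real) \<Rightarrow> bool" where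
  "smooth f \<longleftrightarrow> (\<forall>is x. foldr partial is f differentiable at x)"

definition test_fun :: "point set \<Rightarrow> (point \<Rightarrow> real) \<Rightarrow> bool" where
  "test_fun U \<psi> \<longleftrightarrow>
     smooth \<psi> \<and> compact (closure {x. \<psi> x \<noteq> 0}) \<and> closure {x. \<psi> x \<noteq> 0} \<subseteq> U"

definition test_field :: "point set \<Rightarrow> (point \<Rightarrow> real^3) \<Rightarrow> bool" where
  "test_field U \<Psi> \<longleftrightarrow> (\<forall>i. test_fun U (\<lambda>x. \<Psi> x $ i))"

definition classical_grad :: "(point \<Rightarrow> real) \<Rightarrow> point \<Rightarrow> real^3" where
  "classical_grad \<psi> x = (\<chi> i. partial i \<psi> x)"

definition classical_div :: "(point \<Rightarrow> real^3) \<Rightarrow> point \<Rightarrow> real" where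
  "classical_div \<Psi> x = (\<Sum>i\<in>UNIV. partial i (\<lambda>y. \<Psi> y $ i) x)"

definition classical_curl :: "(point \<Rightarrow> real^3) \<Rightarrow> point \<Rightarrow> real^3" where
  "classical_curl \<Psi> x = vector
     [partial 2 (\<lambda>y. \<Psi> y $ 3) x - partial 3 (\<lambda>y. \<Psi> y $ 2) x,
      partial 3 (\<lambda>y. \<Psi> y $ 1) x - partial 1 (\<lambda>y. \<Psi> y $ 3) x,
      partial 1 (\<lambda>y. \<Psi> y $ 2) x - partial 2 (\<lambda>y. \<Psi> y $ 1) x]"

definition weak_grad :: "point set \<Rightarrow> real L2 \<Rightarrow> (real^3) L2 \<Rightarrow> bool" where
  "weak_grad U \<phi> g \<longleftrightarrow> (\<forall>\<Psi>. test_field U \<Psi> \<longrightarrow>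
     (LINT x:U|lebesgue. rep_L2 g x \<bullet> \<Psi> x) = - (LINT x:U|lebesgue. rep_L2 \<phi> x * classical_div \<Psi> x))"

definition weak_curl :: "point set \<Rightarrow> (real^3) L2 \<Rightarrow> (real^3) L2 \<Rightarrow> bool" where
  "weak_curl U u w \<longleftrightarrow> (\<forall>\<Psi>. test_field U \<Psi> \<longrightarrow>
     (LINT x:U|lebesgue. rep_L2 w x \<bullet> \<Psi> x) = (LINT x:U|lebesgue. rep_L2 u x \<bullet> classical_curl \<Psi> x))"

definition weak_div :: "point set \<Rightarrow> (real^3) L2 \<Rightarrow> real L2 \<Rightarrow> bool" where
  "weak_div U u d \<longleftrightarrow> (\<forall>\<psi>. test_fun U \<psi> \<longrightarrow>
     (LINT x:U|lebesgue. rep_L2 d x * \<psi> x) = - (LINT x:U|lebesgue. rep_L2 u x \<bullet> classical_grad \<psi> x))"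

text \<open>
  The set \<open>S\<close> below is either the open domain or a closed tetrahedron; both have a null
  boundary, so a weak derivative in \<^term>\<open>L2_on S\<close> on the interior of \<open>S\<close> is unique.
\<close>

definition H1 :: "point set \<Rightarrow> real L2 set" where
  "H1 S = {\<phi> \<in> L2_on S. \<exists>g \<in> L2_on S. weak_grad (interior S) \<phi> g}"

definition Hcurl :: "point set \<Rightarrow> (real^3) L2 set" where
  "Hcurl S = {u \<in> L2_on S. \<exists>w \<in> L2_on S. weak_curl (interior S) u w}"

definition Hdiv :: "point set \<Rightarrow> (real^3) L2 set" where
  "Hdiv S = {u \<in> L2_on S. \<exists>d \<in> L2_on S. weak_div (interior S) u d}"

definition wgrad :: "point set \<Rightarrow> real L2 \<Rightarrow> (real^3) L2" where
  "wgrad S \<phi> = (THE g. g \<in> L2_on S \<and> weak_grad (interior S) \<phi> g)"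

definition wcurl :: "point set \<Rightarrow> (real^3) L2 \<Rightarrow> (real^3) L2" where
  "wcurl S u = (THE w. w \<in> L2_on S \<and> weak_curl (interior S) u w)"

definition wdiv :: "point set \<Rightarrow> (real^3) L2 \<Rightarrow> real L2" where
  "wdiv S u = (THE d. d \<in> L2_on S \<and> weak_div (interior S) u d)"

definition broken_curl :: "point set set \<Rightarrow> (real^3) L2 \<Rightarrow> (real^3) L2" where
  "broken_curl \<T> u = (\<Sum>K\<in>\<T>. wcurl K (restr K u))"

text \<open>
  Boundary integrals in the trace sense: \<open>bd_cross K u v\<close> is the integral of
  \<open>(u \<times> v) \<cdot> n\<close> and \<open>bd_flux K \<psi> w\<close> that of \<open>\<psi> w \<cdot> n\<close> over the boundary of \<open>K\<close>.
\<close>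

definition bd_cross :: "point set \<Rightarrow> (real^3) L2 \<Rightarrow> (real^3) L2 \<Rightarrow> real" where
  "bd_cross K u v = ip K (wcurl K u) v - ip K u (wcurl K v)"

definition bd_flux :: "point set \<Rightarrow> real L2 \<Rightarrow> (real^3) L2 \<Rightarrow> real" where
  "bd_flux K \<psi> w = ip K (wgrad K \<psi>) w + ip K \<psi> (wdiv K w)"


section \<open>Geometry, coefficients and curves\<close>

text \<open>Near each boundary point, \<open>\<Omega>\<close> is the region below a Lipschitz graph in some direction \<open>e\<close>.\<close>

definition lipschitz_boundary :: "point set \<Rightarrow> bool" where
  "lipschitz_boundary \<Omega> \<longleftrightarrow> (\<forall>x \<in> frontier \<Omega>. \<exists>e r L \<gamma>. norm e = 1 \<and> r > 0 \<and>
     L-lipschitz_on {z. z \<bullet> e = 0} \<gamma> \<and>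
     (\<forall>y \<in> ball x r. y \<in> \<Omega> \<longleftrightarrow> y \<bullet> e < \<gamma> (y - (y \<bullet> e) *\<^sub>R e)))"

definition polyhedral_boundary :: "point set \<Rightarrow> bool" where
  "polyhedral_boundary \<Omega> \<longleftrightarrow>
     (\<exists>\<P>. finite \<P> \<and> (\<forall>P\<in>\<P>. polytope P \<and> aff_dim P = 2) \<and> frontier \<Omega> = \<Union>\<P>)"

definition polyhedral_lipschitz_domain :: "point set \<Rightarrow> bool" where
  "polyhedral_lipschitz_domain \<Omega> \<longleftrightarrow>
     open \<Omega> \<and> connected \<Omega> \<and> \<Omega> \<noteq> {} \<and> bounded \<Omega> \<and> polyhedral_boundary \<Omega> \<and> lipschitz_boundary \<Omega>"

definition tetrahedral_mesh :: "point set \<Rightarrow> point set set \<Rightarrow> bool" where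
  "tetrahedral_mesh \<Omega> \<T> \<longleftrightarrow>
     triangulation \<T> \<and> (\<forall>K\<in>\<T>. 3 simplex K) \<and> \<Union>\<T> = closure \<Omega>"

definition elliptic_tensor :: "point set \<Rightarrow> real set \<Rightarrow> (real \<Rightarrow> point \<Rightarrow> real^3^3) \<Rightarrow> bool" where
  "elliptic_tensor \<Omega> I \<epsilon> \<longleftrightarrow> (\<exists>\<alpha>>0. \<exists>C. \<forall>t\<in>I.
     \<epsilon> t \<in> borel_measurable (lebesgue_on \<Omega>) \<and>
     (AE x in lebesgue_on \<Omega>. (\<forall>i j. \<bar>\<epsilon> t x $ i $ j\<bar> \<le> C) \<and> transpose (\<epsilon> t x) = \<epsilon> t x \<and>
        (\<forall>\<xi>. \<alpha> * (norm \<xi>)\<^sup>2 \<le> \<xi> \<bullet> (\<epsilon> t x *v \<xi>))))"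

text \<open>
  The ambient \<open>L\<^sup>2\<close> norm is also used for curves in the finite-dimensional product space of
  elementwise fields, where all norms are equivalent. Derivatives at end points are one-sided.
\<close>

definition C1_curve :: "real set \<Rightarrow> (real \<Rightarrow> 'v::real_normed_vector) \<Rightarrow> (real \<Rightarrow> 'v) \<Rightarrow> bool" where
  "C1_curve I f f' \<longleftrightarrow>
     (\<forall>t\<in>I. (f has_vector_derivative f' t) (at t within I)) \<and> continuous_on I f'"

text \<open>The norm of a pair is the graph norm of \<open>H(curl)\<close>, respectively \<open>H(div)\<close>.\<close>

definition C0_curve_Hcurl :: "point set \<Rightarrow> real set \<Rightarrow> (real \<Rightarrow> (real^3) L2) \<Rightarrow> bool" where
  "C0_curve_Hcurl \<Omega> I u \<longleftrightarrow>
     (\<forall>t\<in>I. u t \<in> Hcurl \<Omega>) \<and> continuous_on I (\<lambda>t. (u t, wcurl \<Omega> (u t)))"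

definition C0_curve_Hdiv :: "point set \<Rightarrow> real set \<Rightarrow> (real \<Rightarrow> (real^3) L2) \<Rightarrow> bool" where
  "C0_curve_Hdiv \<Omega> I u \<longleftrightarrow>
     (\<forall>t\<in>I. u t \<in> Hdiv \<Omega>) \<and> continuous_on I (\<lambda>t. (u t, wdiv \<Omega> (u t)))"


section \<open>The hybrid method\<close>

definition product_space ::
    "point set \<Rightarrow> point set set \<Rightarrow> (point set \<Rightarrow> (real^3) L2 set) \<Rightarrow> (real^3) L2 set" where
  "product_space \<Omega> \<T> V1 = {u \<in> L2_on \<Omega>. \<forall>K\<in>\<T>. restr K u \<in> V1 K}"

definition discrete_gauss ::
    "point set \<Rightarrow> real L2 set \<Rightarrow> (real^3) L2 \<Rightarrow> real L2 \<Rightarrow> (real^3) L2 \<Rightarrow> bool" where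
  "discrete_gauss K V0K D \<rho> Dhat \<longleftrightarrow> (\<forall>\<phi> \<in> V0K.
     ip K (wgrad K \<phi>) D + ip K \<phi> \<rho> - bd_flux K \<phi> (restr K Dhat) = 0)"

end

theory Submission
  imports Defs "HOL-Computational_Algebra.Polynomial"
begin

text \<open>
  Testing \<open>Dhat' + J = curl Hhat\<close> with a gradient kills the curl, so that charge conservation
  makes \<open>\<langle>Dhat, grad \<psi>\<rangle> + \<langle>\<rho>, \<psi>\<rangle>\<close> independent of time for every test function \<open>\<psi>\<close>. Hence
  \<open>div Dhat - \<rho>\<close> keeps its initial value. For \<open>\<phi>\<close> in \<open>V0 K\<close> the first equation of the
  method may be tested with \<open>grad \<phi>\<close>, whose curl vanishes; it then says that
  \<open>D' - Dhat'\<close> is orthogonal to \<open>grad \<phi>\<close> on \<open>K\<close>. Together, the Gauss functional is constant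
  in time. A curve is only ever differentiated after pairing it with a fixed field, so no integral
  of a curve in \<open>L\<^sup>2\<close> is needed.
\<close>

section \<open>Test functions\<close>

text \<open>The obstacle lies in the operators: \<open>wgrad\<close>, \<open>wcurl\<close> and
  \<open>wdiv\<close> are definite descriptions, so a boundary term can be evaluated only once weak
  derivatives are known to be unique. That uniqueness is the fundamental lemma of the calculus of
  variations, which needs a supply of functions that are \<open>smooth\<close> in the sense of
  iterated partial derivatives; they are built from exp (- 1 / s). That gradients have no weak curl
  and curls no weak divergence is transposed from test fields, hence rests on the symmetry of second
  derivatives. For times other than \<open>t0\<close>, membership of \<open>Dhat t\<close> in
  \<open>Hdiv \<Omega>\<close> is a conclusion: a candidate for the divergence comes from
  integrating charge conservation in time and is checked against test functions. With it, the
  \<rho>-terms of the Gauss functional cancel up to a constant, and only the pairing of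
  \<open>D - Dhat\<close> with a gradient could still vary with time.\<close>

lemma partial_eqI:
  assumes "(f has_derivative f') (at x)"
  shows "partial i f x = f' (axis i 1)"
  using frechet_derivative_at[OF assms] by (simp add: partial_def)

lemma partial_diff:
  assumes "f differentiable at x" "g differentiable at x"
  shows "partial i (\<lambda>y. f y - g y) x = partial i f x - partial i g x"
  using assms unfolding partial_def frechet_derivative_works
  by (intro partial_eqI[unfolded partial_def]) (rule has_derivative_diff)

lemma smooth_differentiable: "smooth f \<Longrightarrow> f differentiable at x"
  unfolding smooth_def by (elim allE[of _ "[]"]) simp

lemma smooth_partial:
  assumes "smooth f"
  shows "smooth (partial i f)"
  unfolding smooth_def
proof (intro allI)
  show "foldr partial is (partial i f) differentiable at x" for "is" x
    using assms[unfolded smooth_def, rule_format, of "is @ [i]" x] by simp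
qed

lemma smooth_continuous: "smooth f \<Longrightarrow> continuous_on S f"
  by (meson continuous_at_imp_continuous_on differentiable_imp_continuous_within smooth_differentiable)

lemma smooth_diff:
  assumes "smooth f" "smooth g"
  shows "smooth (\<lambda>x. f x - g x)"
proof -
  have d: "foldr partial is f differentiable at x" "foldr partial is g differentiable at x" for "is" x
    by (fact assms(1)[unfolded smooth_def, rule_format] assms(2)[unfolded smooth_def, rule_format])+
  have *: "foldr partial is (\<lambda>x. f x - g x) = (\<lambda>x. foldr partial is f x - foldr partial is g x)" for "is"
  proof (induction "is")
    case (Cons i "is")
    show ?case
      unfolding foldr_Cons comp_apply Cons.IH
      by (rule ext) (rule partial_diff[OF d])
  qed simp
  show ?thesis unfolding smooth_def * by (rule allI)+ (rule differentiable_diff[OF d])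
qed

section \<open>Symmetry of second partial derivatives\<close>

lemma DERIV_along_axis:
  assumes f: "smooth f"
  shows "((\<lambda>s. f (x + s *\<^sub>R axis i 1)) has_real_derivative partial i f (x + s *\<^sub>R axis i 1)) (at s)"
proof -
  let ?y = "x + s *\<^sub>R axis i 1"
  have "(f has_derivative frechet_derivative f (at ?y)) (at ?y)"
    using smooth_differentiable[OF f] frechet_derivative_works by blast
  moreover have "((\<lambda>s. x + s *\<^sub>R axis i 1) has_derivative (\<lambda>h. h *\<^sub>R axis i 1)) (at s)"
    by (auto intro!: derivative_eq_intros)
  ultimately have *: "((\<lambda>s. f (x + s *\<^sub>R axis i 1)) has_derivative
      (\<lambda>h. frechet_derivative f (at ?y) (h *\<^sub>R axis i 1))) (at s)"
    by (rule has_derivative_compose[rotated])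
  have "linear (frechet_derivative f (at ?y))"
    by (intro linear_frechet_derivative smooth_differentiable f)
  then show ?thesis
    using * by (simp add: has_field_derivative_def linear_cmul partial_def mult_commute_abs)
qed

text \<open>Two applications of the mean value theorem: one in direction i to the increment of
  \<open>f\<close> by \<open>h\<close> in direction j, one in direction j to
  \<open>partial i f\<close>. The left-hand side is symmetric in i and j while the right-hand side
  is not visibly so, which is what makes it useful.\<close>

lemma mixed_difference_eq:
  assumes f: "smooth f" and h: "0 < h"
  obtains s t where "0 < s" "s < h" "0 < t" "t < h"
    "f (x + h *\<^sub>R axis i 1 + h *\<^sub>R axis j 1) - f (x + h *\<^sub>R axis i 1) - (f (x + h *\<^sub>R axis j 1) - f x)
      = h * h * partial j (partial i f) (x + s *\<^sub>R axis i 1 + t *\<^sub>R axis j 1)"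
proof -
  let ?g = "\<lambda>s. f ((x + h *\<^sub>R axis j 1) + s *\<^sub>R axis i 1) - f (x + s *\<^sub>R axis i 1)"
  have "\<exists>s. 0 < s \<and> s < h \<and> ?g h - ?g 0 = (h - 0) *
      (partial i f ((x + h *\<^sub>R axis j 1) + s *\<^sub>R axis i 1) - partial i f (x + s *\<^sub>R axis i 1))"
    by (rule MVT2[OF h]) (rule DERIV_diff DERIV_along_axis f)+
  then obtain s where s: "0 < s" "s < h" "?g h - ?g 0 = h *
      (partial i f ((x + h *\<^sub>R axis j 1) + s *\<^sub>R axis i 1) - partial i f (x + s *\<^sub>R axis i 1))"
    by auto
  let ?k = "\<lambda>t. partial i f ((x + s *\<^sub>R axis i 1) + t *\<^sub>R axis j 1)"
  have "\<exists>t. 0 < t \<and> t < h \<and> ?k h - ?k 0 = (h - 0) *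
      partial j (partial i f) ((x + s *\<^sub>R axis i 1) + t *\<^sub>R axis j 1)"
    by (rule MVT2[OF h]) (rule DERIV_along_axis smooth_partial f)+
  then obtain t where t: "0 < t" "t < h" "?k h - ?k 0 = h *
      partial j (partial i f) ((x + s *\<^sub>R axis i 1) + t *\<^sub>R axis j 1)"
    by auto
  show thesis
  proof (rule that[OF s(1,2) t(1,2)])
    have "?g h - ?g 0 = h * (?k h - ?k 0)"
      using s(3) by (simp add: algebra_simps)
    then show "f (x + h *\<^sub>R axis i 1 + h *\<^sub>R axis j 1) - f (x + h *\<^sub>R axis i 1) - (f (x + h *\<^sub>R axis j 1) - f x)
      = h * h * partial j (partial i f) (x + s *\<^sub>R axis i 1 + t *\<^sub>R axis j 1)"
      unfolding t(3) by (simp add: algebra_simps)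
  qed
qed

text \<open>The second difference does not depend on the order of i and j, so for each h > 0 the two
  mixed derivatives take a common value at points within 2 h of x. Both are continuous, being
  themselves differentiable, and h is sent to 0 along 1 / (n + 1).\<close>

lemma partial_commute:
  assumes f: "smooth f"
  shows "partial i (partial j f) x = partial j (partial i f) x"
proof -
  have "\<exists>p q. dist p x < 2 * h \<and> dist q x < 2 * h \<and> partial i (partial j f) p = partial j (partial i f) q"
    if h: "0 < h" for h
  proof -
    have close: "dist (x + s *\<^sub>R axis k 1 + t *\<^sub>R axis l 1) x < 2 * h"
      if "0 < s" "s < h" "0 < t" "t < h" for s t and k l :: 3
    proof -
      have "norm (s *\<^sub>R axis k 1 + t *\<^sub>R axis l (1::real)) \<le> s + t"
        using that norm_triangle_ineq[of "s *\<^sub>R axis k (1::real)" "t *\<^sub>R axis l (1::real)"] by simp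
      then show ?thesis using that by (simp add: dist_norm add.assoc)
    qed
    obtain s t where st: "0 < s" "s < h" "0 < t" "t < h"
      "f (x + h *\<^sub>R axis i 1 + h *\<^sub>R axis j 1) - f (x + h *\<^sub>R axis i 1) - (f (x + h *\<^sub>R axis j 1) - f x)
      = h * h * partial j (partial i f) (x + s *\<^sub>R axis i 1 + t *\<^sub>R axis j 1)"
      using mixed_difference_eq[OF f h] .
    obtain s' t' where st': "0 < s'" "s' < h" "0 < t'" "t' < h"
      "f (x + h *\<^sub>R axis j 1 + h *\<^sub>R axis i 1) - f (x + h *\<^sub>R axis j 1) - (f (x + h *\<^sub>R axis i 1) - f x)
      = h * h * partial i (partial j f) (x + s' *\<^sub>R axis j 1 + t' *\<^sub>R axis i 1)"
      using mixed_difference_eq[OF f h] .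
    have c: "x + h *\<^sub>R axis i 1 + h *\<^sub>R axis j 1 = x + h *\<^sub>R axis j 1 + h *\<^sub>R axis i 1"
      by simp
    have "h * h * partial i (partial j f) (x + s' *\<^sub>R axis j 1 + t' *\<^sub>R axis i 1)
        = h * h * partial j (partial i f) (x + s *\<^sub>R axis i 1 + t *\<^sub>R axis j 1)"
      using st(5) st'(5) unfolding c by linarith
    then have "partial i (partial j f) (x + s' *\<^sub>R axis j 1 + t' *\<^sub>R axis i 1)
        = partial j (partial i f) (x + s *\<^sub>R axis i 1 + t *\<^sub>R axis j 1)"
      using h by simp
    then show ?thesis
      using close[OF st(1-4), of i j] close[OF st'(1-4), of j i] by blast
  qed
  then have "\<forall>n. \<exists>p q. dist p x < 2 * inverse (real (Suc n)) \<and> dist q x < 2 * inverse (real (Suc n))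
      \<and> partial i (partial j f) p = partial j (partial i f) q"
    by (meson inverse_positive_iff_positive of_nat_0_less_iff zero_less_Suc)
  then obtain p q where
    p: "\<And>n. dist (p n) x < 2 * inverse (real (Suc n))" and
    q: "\<And>n. dist (q n) x < 2 * inverse (real (Suc n))" and
    eq: "\<And>n. partial i (partial j f) (p n) = partial j (partial i f) (q n)" by metis
  have z: "(\<lambda>n. 2 * inverse (real (Suc n))) \<longlonglongrightarrow> 0"
    using tendsto_mult_right_zero[OF LIMSEQ_inverse_real_of_nat] by simp
  have lim: "r \<longlonglongrightarrow> x" if "\<And>n. dist (r n) x < 2 * inverse (real (Suc n))" for r
    unfolding tendsto_dist_iff[of r]
    by (rule Lim_null_comparison[OF _ z]) (use that in \<open>auto intro!: always_eventually less_imp_le\<close>)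
  have cont: "isCont (partial k (partial l f)) x" for k l
    using f by (simp add: smooth_partial smooth_differentiable differentiable_imp_continuous_within)
  have "(\<lambda>n. partial i (partial j f) (p n)) \<longlonglongrightarrow> partial i (partial j f) x"
       "(\<lambda>n. partial j (partial i f) (q n)) \<longlonglongrightarrow> partial j (partial i f) x"
    by (rule isCont_tendsto_compose[OF cont lim]; fact p q)+
  then show ?thesis unfolding eq by (rule LIMSEQ_unique)
qed

section \<open>Supports of test functions and closure properties\<close>

lemma closure_support_subset:
  assumes "\<And>x. x \<notin> closure {x. f x \<noteq> 0} \<Longrightarrow> g x = (0::real)"
  shows "closure {x. g x \<noteq> 0} \<subseteq> closure {x. f x \<noteq> (0::real)}"
  using assms by (intro closure_minimal) auto

lemma test_fun_subset:
  assumes "test_fun U f" "smooth g" and sub: "closure {x. g x \<noteq> 0} \<subseteq> closure {x. f x \<noteq> 0}"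
  shows "test_fun U g"
proof -
  have "bounded (closure {x. g x \<noteq> 0})"
    using assms(1) by (intro bounded_subset[OF _ sub] compact_imp_bounded) (simp add: test_fun_def)
  then have "compact (closure {x. g x \<noteq> 0})" by (simp add: compact_eq_bounded_closed)
  then show ?thesis using assms by (auto simp: test_fun_def)
qed

lemma test_fun_mono: "test_fun U f \<Longrightarrow> U \<subseteq> V \<Longrightarrow> test_fun V f"
  by (auto simp: test_fun_def)

lemma test_fun_partial:
  assumes "test_fun U f"
  shows "test_fun U (partial i f)"
proof (rule test_fun_subset[OF assms])
  show "smooth (partial i f)" using assms by (simp add: test_fun_def smooth_partial)
  show "closure {x. partial i f x \<noteq> 0} \<subseteq> closure {x. f x \<noteq> 0}"
  proof (rule closure_support_subset)
    fix x assume x: "x \<notin> closure {x. f x \<noteq> 0}"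
    have "(f has_derivative (\<lambda>_. 0)) (at x)"
    proof (rule has_derivative_transform_within_open[OF has_derivative_const[of "0::real"]])
      show "open (- closure {x. f x \<noteq> 0})" by auto
      show "x \<in> - closure {x. f x \<noteq> 0}" using x by simp
    qed (use closure_subset[of "{x. f x \<noteq> 0}"] in auto)
    then show "partial i f x = 0" by (rule partial_eqI)
  qed
qed

lemma test_fun_diff:
  assumes f: "test_fun U f" and g: "test_fun U g"
  shows "test_fun U (\<lambda>x. f x - g x)"
proof -
  have sub: "closure {x. f x - g x \<noteq> 0} \<subseteq> closure {x. f x \<noteq> 0} \<union> closure {x. g x \<noteq> 0}"
    unfolding closure_Un[symmetric] by (rule closure_mono) auto
  moreover have "bounded (closure {x. f x \<noteq> 0} \<union> closure {x. g x \<noteq> 0})"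
    using f g by (auto simp: test_fun_def dest: compact_imp_bounded)
  ultimately have "bounded (closure {x. f x - g x \<noteq> 0})"
    by (rule bounded_subset[rotated])
  then have "compact (closure {x. f x - g x \<noteq> 0})" by (simp add: compact_eq_bounded_closed)
  then show ?thesis using f g sub by (auto simp: test_fun_def smooth_diff)
qed

lemma test_fun_zero: "test_fun U (\<lambda>x. 0)"
proof -
  have "partial i (\<lambda>x. 0) = (\<lambda>x. 0)" for i
    by (rule ext) (simp add: partial_def)
  then have *: "foldr partial is (\<lambda>x. 0) = (\<lambda>x. 0)" for "is"
    by (induction "is") simp_all
  show ?thesis unfolding test_fun_def smooth_def * by simp
qed

lemma test_fun_eq_0: "test_fun U f \<Longrightarrow> x \<notin> U \<Longrightarrow> f x = 0"
  unfolding test_fun_def using closure_subset[of "{x. f x \<noteq> 0}"] by auto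

section \<open>Bounds and integrals of test functions\<close>

lemma test_fun_bounded:
  assumes "test_fun U f"
  obtains M R where "\<And>x. \<bar>f x\<bar> \<le> M" "\<And>x. norm x > R \<Longrightarrow> f x = 0" "M > 0" "R > 0"
proof -
  let ?C = "closure {x. f x \<noteq> 0}"
  have c: "compact ?C" and s: "smooth f" using assms by (auto simp: test_fun_def)
  have "bounded (f ` ?C)"
    using c s by (intro compact_imp_bounded compact_continuous_image smooth_continuous)
  then obtain M where M: "M > 0" "\<And>x. x \<in> ?C \<Longrightarrow> \<bar>f x\<bar> \<le> M"
    unfolding bounded_pos ball_simps real_norm_def by metis
  obtain R where R: "R > 0" "\<And>x. x \<in> ?C \<Longrightarrow> norm x \<le> R"
    using compact_imp_bounded[OF c] unfolding bounded_pos by metis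
  have out: "f x = 0" if "x \<notin> ?C" for x using that closure_subset[of "{x. f x \<noteq> 0}"] by auto
  show thesis
  proof (rule that[OF _ _ M(1) R(1)])
    show "\<bar>f x\<bar> \<le> M" for x using M(1) M(2)[of x] out[of x] by (metis abs_zero less_imp_le)
    show "f x = 0" if "norm x > R" for x using R(2)[of x] out[of x] that by linarith
  qed
qed

lemma test_fun_measurable: "test_fun U f \<Longrightarrow> f \<in> borel_measurable borel"
  by (auto simp: test_fun_def intro: borel_measurable_continuous_onI smooth_continuous)

text \<open>Stated for \<open>lborel\<close>, where translation invariance is used later; test
  functions are continuous, hence Borel, and pass to \<open>lebesgue\<close> by completion.\<close>

lemma integrable_test_fun:
  assumes "test_fun U f"
  shows "integrable lborel f"
proof -
  obtain M R where M: "\<And>x. \<bar>f x\<bar> \<le> M" and R: "\<And>x. norm x > R \<Longrightarrow> f x = 0"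
    using test_fun_bounded[OF assms] by metis
  show ?thesis
  proof (rule Bochner_Integration.integrable_bound)
    show "integrable lborel (\<lambda>x. M * indicator (cball (0::point) R) x :: real)"
      using emeasure_bounded_finite[OF bounded_cball, of "0::point" R] by simp
    show "AE x in lborel. norm (f x) \<le> norm (M * indicator (cball (0::point) R) x)"
      using M R by (auto simp: indicator_def intro!: AE_I2 order_trans[OF M])
  qed (use test_fun_measurable[OF assms] in simp)
qed

lemma square_integrable_test_fun:
  assumes "test_fun U f"
  shows "square_integrable f"
proof -
  obtain M R where M: "\<And>x. \<bar>f x\<bar> \<le> M" 
    using test_fun_bounded[OF assms] by metis
  have "integrable lborel (\<lambda>x. (norm (f x))\<^sup>2)"
  proof (rule Bochner_Integration.integrable_bound)
    show "integrable lborel (\<lambda>x. M * f x)" using integrable_test_fun[OF assms] by simp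
    show "AE x in lborel. norm ((norm (f x))\<^sup>2) \<le> norm (M * f x)"
    proof (rule AE_I2)
      fix x
      have "\<bar>f x\<bar> * \<bar>f x\<bar> \<le> \<bar>M\<bar> * \<bar>f x\<bar>"
        using M[of x] by (intro mult_right_mono) auto
      then show "norm ((norm (f x))\<^sup>2) \<le> norm (M * f x)"
        by (simp add: power2_eq_square abs_mult)
    qed
  qed (use test_fun_measurable[OF assms] in measurable)
  then show ?thesis
    using test_fun_measurable[OF assms] unfolding square_integrable_def
    by (auto intro!: measurable_completion simp: integrable_completion)
qed

text \<open>
  By translation invariance every difference quotient of \<open>f\<close> has integral zero, and the
  difference quotients are dominated on a fixed ball.
\<close>

lemma integral_partial_eq_0:
  assumes f: "test_fun U f"
  shows "(LINT x|lborel. partial i f x) = 0"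
proof -
  let ?e = "axis i (1::real) :: point"
  define q where "q n x = real (Suc n) * (f (inverse (real (Suc n)) *\<^sub>R ?e + x) - f x)" for n x
  obtain R where R: "\<And>x. norm x > R \<Longrightarrow> f x = 0" "R > 0"
    using test_fun_bounded[OF f] by metis
  obtain M where M: "\<And>x. \<bar>partial i f x\<bar> \<le> M"
    using test_fun_bounded[OF test_fun_partial[OF f]] by metis
  have D: "((\<lambda>s. f (s *\<^sub>R ?e + x)) has_real_derivative partial i f (s *\<^sub>R ?e + x)) (at s)" for x s
    using DERIV_along_axis[of f x i s] f by (simp add: add.commute test_fun_def)
  have 0: "(LINT x|lborel. q n x) = 0" for n
  proof -
    let ?c = "inverse (real (Suc n)) *\<^sub>R ?e"
    have m[measurable]: "f \<in> borel_measurable borel" by (rule test_fun_measurable[OF f])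
    have "(LINT x|lborel. f (?c + x)) = (LINT x|distr lborel borel ((+) ?c). f x)"
      by (subst integral_distr) auto
    moreover have "integrable lborel (\<lambda>x. f (?c + x))"
      using integrable_test_fun[OF f] integrable_distr_eq[of "(+) ?c" lborel borel f]
      by (simp add: lborel_distr_plus)
    ultimately show ?thesis
      unfolding q_def using integrable_test_fun[OF f] by (simp add: lborel_distr_plus)
  qed
  have "(\<lambda>n. LINT x|lborel. q n x) \<longlonglongrightarrow> (LINT x|lborel. partial i f x)"
  \<comment> \<open>The increments are at most 1, so for x outside the ball of radius
    \<open>R + 1\<close> both x and its translate have norm above \<open>R\<close>, where
    \<open>f\<close> vanishes. Inside, the mean value theorem bounds the quotient by the bound
    \<open>M\<close> of the partial derivative.\<close>
  proof (rule integral_dominated_convergence[where w="\<lambda>x. M * indicator (cball 0 (R + 1)) x"])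
    show "integrable lborel (\<lambda>x. M * indicator (cball (0::point) (R+1)) x :: real)"
      using emeasure_bounded_finite[OF bounded_cball, of "0::point" "R+1"] by simp
    have m[measurable]: "f \<in> borel_measurable borel" by (rule test_fun_measurable[OF f])
    show "q n \<in> borel_measurable lborel" for n unfolding q_def by measurable
    show "partial i f \<in> borel_measurable lborel"
      using test_fun_measurable[OF test_fun_partial[OF f]] by simp
    show "AE x in lborel. (\<lambda>n. q n x) \<longlonglongrightarrow> partial i f x"
    proof (rule AE_I2)
      fix x
      have "((\<lambda>h. (f (h *\<^sub>R ?e + x) - f x) / h) \<longlongrightarrow> partial i f x) (at 0)"
        using D[of x 0] by (simp add: DERIV_def)
      moreover have "filterlim (\<lambda>n. inverse (real (Suc n))) (at 0) sequentially"
        by (rule filterlim_atI[OF LIMSEQ_inverse_real_of_nat]) auto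
      ultimately have "(\<lambda>n. (f (inverse (real (Suc n)) *\<^sub>R ?e + x) - f x) / inverse (real (Suc n)))
          \<longlonglongrightarrow> partial i f x"
        by (rule filterlim_compose)
      then show "(\<lambda>n. q n x) \<longlonglongrightarrow> partial i f x"
        by (simp add: q_def field_simps)
    qed
    show "AE x in lborel. norm (q n x) \<le> M * indicator (cball 0 (R + 1)) x" for n
    proof (rule AE_I2)
      fix x
      let ?h = "inverse (real (Suc n))"
      have h: "0 < ?h" "?h \<le> 1" by (auto simp: field_simps)
      show "norm (q n x) \<le> M * indicator (cball 0 (R + 1)) x"
      proof (cases "x \<in> cball 0 (R + 1)")
        case True
        have "\<exists>s. 0 < s \<and> s < ?h \<and> f (?h *\<^sub>R ?e + x) - f (0 *\<^sub>R ?e + x)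
            = (?h - 0) * partial i f (s *\<^sub>R ?e + x)"
          by (rule MVT2) (use h D in auto)
        then obtain s where "f (?h *\<^sub>R ?e + x) - f x = ?h * partial i f (s *\<^sub>R ?e + x)" by auto
        then have "q n x = partial i f (s *\<^sub>R ?e + x)" by (simp add: q_def)
        then show ?thesis using True M by simp
      next
        case False
        then have x: "norm x > R + 1" by simp
        have "norm x \<le> norm (?h *\<^sub>R ?e + x) + norm (?h *\<^sub>R ?e)"
          using norm_triangle_ineq4[of "?h *\<^sub>R ?e + x" "?h *\<^sub>R ?e"] by simp
        moreover have "norm (?h *\<^sub>R ?e) \<le> 1" using h by simp
        ultimately have "norm (?h *\<^sub>R ?e + x) > R" using x by linarith
        then show ?thesis using x R False by (simp add: q_def)
      qed
    qed
  qed
  then show ?thesis unfolding 0 by (simp add: LIMSEQ_const_iff)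
qed

section \<open>The fundamental lemma of the calculus of variations\<close>

text \<open>The classical flat function exp (- 1 / s), continued by 0, with a polynomial factor in 1
  / s. The factor makes the family closed under differentiation; \<open>flat_exp 1\<close> is the
  flat function itself.\<close>

definition flat_exp :: "real poly \<Rightarrow> real \<Rightarrow> real" where
  "flat_exp p s = (if 0 < s then poly p (1 / s) * exp (- (1 / s)) else 0)"

lemma poly_div_exp_tendsto_0: "((\<lambda>x. poly p x / exp x) \<longlongrightarrow> 0) at_top" for p :: "real poly"
proof -
  have "((\<lambda>x. \<Sum>i\<le>degree p. coeff p i * (x ^ i / exp x)) \<longlongrightarrow> (\<Sum>i\<le>degree p. coeff p i * 0)) at_top"
    by (intro tendsto_sum tendsto_mult tendsto_const tendsto_power_div_exp_0)
  then show ?thesis by (simp add: poly_altdef sum_divide_distrib)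
qed

lemma flat_exp_tendsto_0: "(flat_exp p \<longlongrightarrow> 0) (at 0)"
proof -
  have "((\<lambda>s. poly p (inverse s) / exp (inverse s)) \<longlongrightarrow> 0) (at_right 0)"
    by (rule filterlim_compose[OF poly_div_exp_tendsto_0 filterlim_inverse_at_top_right])
  then have "(flat_exp p \<longlongrightarrow> 0) (at_right 0)"
    by (rule Lim_transform_eventually)
      (auto simp: eventually_at_filter flat_exp_def exp_minus field_simps)
  moreover have "(flat_exp p \<longlongrightarrow> 0) (at_left 0)"
    by (rule Lim_transform_eventually[OF tendsto_const])
      (auto simp: eventually_at_filter flat_exp_def)
  ultimately show ?thesis by (simp add: filterlim_split_at_real)
qed

text \<open>With y = 1 / s, the derivative of p(y) exp (- y) in s is y^2 (p(y) - p'(y)) exp (- y);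
  the coefficient list \<open>[:0, 0, 1:]\<close> is y^2.\<close>

lemma DERIV_flat_exp:
  "(flat_exp p has_real_derivative flat_exp ([:0, 0, 1:] * (p - pderiv p)) s) (at s)"
proof (cases s "0::real" rule: linorder_cases)
  case less
  have "((\<lambda>_. 0) has_real_derivative 0) (at s)" by simp
  then have "(flat_exp p has_real_derivative 0) (at s)"
    by (rule has_field_derivative_transform_within_open[of _ _ _ "{..<0}"])
      (use less in \<open>auto simp: flat_exp_def\<close>)
  then show ?thesis using less by (simp add: flat_exp_def)
next
  case equal
  \<comment> \<open>Division by h multiplies the polynomial by y = 1 / h, so the difference quotient
    at 0 is again a member of the family, \<open>flat_exp (pCons 0 p)\<close>, and tends to
    0.\<close>
  have "((\<lambda>h. (flat_exp p (0 + h) - flat_exp p 0) / h) \<longlongrightarrow> 0) (at 0)"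
    by (rule Lim_transform_eventually[OF flat_exp_tendsto_0[of "pCons 0 p"]])
      (auto simp: eventually_at_filter flat_exp_def)
  then show ?thesis using equal by (simp add: DERIV_def flat_exp_def)
next
  case greater
  have "((\<lambda>s. poly p (1 / s) * exp (- (1 / s))) has_real_derivative
      flat_exp ([:0, 0, 1:] * (p - pderiv p)) s) (at s)"
    using greater
    by (auto intro!: derivative_eq_intros DERIV_chain2[OF poly_DERIV]
        simp: flat_exp_def field_simps power2_eq_square)
  then show ?thesis
    by (rule has_field_derivative_transform_within_open[of _ _ _ "{0<..}"])
      (use greater in \<open>auto simp: flat_exp_def\<close>)
qed

text \<open>
  This class is closed under partial derivatives, so that \<^const>\<open>smooth\<close>, which quantifies over
  iterated partial derivatives, reduces to differentiability of its members.
\<close>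

inductive flat_generated :: "(point \<Rightarrow> real) \<Rightarrow> bool" where
  const: "flat_generated (\<lambda>x. c)"
| flat: "flat_generated (\<lambda>x. flat_exp p (c * x $ i + d))"
| add: "flat_generated f \<Longrightarrow> flat_generated g \<Longrightarrow> flat_generated (\<lambda>x. f x + g x)"
| mult: "flat_generated f \<Longrightarrow> flat_generated g \<Longrightarrow> flat_generated (\<lambda>x. f x * g x)"

text \<open>Differentiability and membership of the partial derivatives are carried through one
  induction, with an explicit derivative \<open>f'\<close>, so that the sum and product rules can be
  applied to total derivatives and evaluated on the axes afterwards.\<close>

lemma flat_generated_deriv:
  assumes "flat_generated f"
  shows "\<exists>f'. (\<forall>x. (f has_derivative f' x) (at x)) \<and> (\<forall>j. flat_generated (\<lambda>x. f' x (axis j 1)))"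
  using assms
proof induction
  case (const c)
  show ?case
    by (rule exI[of _ "\<lambda>_ _. 0"]) (simp add: flat_generated.const)
next
  case (flat p c i d)
  let ?q = "[:0, 0, 1:] * (p - pderiv p)"
  have D: "((\<lambda>x. flat_exp p (c * x $ i + d)) has_derivative
      (\<lambda>v. flat_exp ?q (c * x $ i + d) * (c * v $ i))) (at x)" for x :: point
  proof -
    have "((\<lambda>x. c * x $ i + d) has_derivative (\<lambda>v. c * v $ i)) (at x)"
      by (auto intro!: derivative_eq_intros bounded_linear.has_derivative[OF bounded_linear_vec_nth])
    moreover have "(flat_exp p has_derivative (*) (flat_exp ?q (c * x $ i + d))) (at (c * x $ i + d))"
      using DERIV_flat_exp by (simp only: has_field_derivative_def)
    ultimately show ?thesis by (rule has_derivative_compose)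
  qed
  have "flat_generated (\<lambda>x. flat_exp ?q (c * x $ i + d) * (c * axis j 1 $ i))" for j
    by (rule flat_generated.mult[OF flat_generated.flat flat_generated.const])
  with D show ?case
    by (intro exI[of _ "\<lambda>x v. flat_exp ?q (c * x $ i + d) * (c * v $ i)"]) blast
next
  case (add f g)
  then obtain f' g' where
    f': "\<And>x. (f has_derivative f' x) (at x)" "\<And>j. flat_generated (\<lambda>x. f' x (axis j 1))" and
    g': "\<And>x. (g has_derivative g' x) (at x)" "\<And>j. flat_generated (\<lambda>x. g' x (axis j 1))"
    by metis
  show ?case
    by (intro exI[of _ "\<lambda>x v. f' x v + g' x v"] conjI allI has_derivative_add f' g'
        flat_generated.add)
next
  case (mult f g)
  then obtain f' g' where
    f': "\<And>x. (f has_derivative f' x) (at x)" "\<And>j. flat_generated (\<lambda>x. f' x (axis j 1))" and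
    g': "\<And>x. (g has_derivative g' x) (at x)" "\<And>j. flat_generated (\<lambda>x. g' x (axis j 1))"
    by metis
  show ?case
    by (intro exI[of _ "\<lambda>x v. f x * g' x v + f' x v * g x"] conjI allI has_derivative_mult f' g'
        flat_generated.add flat_generated.mult mult)
qed

lemma smooth_flat_generated:
  assumes "flat_generated f"
  shows "smooth f"
proof -
  have step: "flat_generated (partial i f)" "\<And>x. f differentiable at x" if gen: "flat_generated f" for i f
  proof -
    obtain f' where f': "\<And>x. (f has_derivative f' x) (at x)" "\<And>j. flat_generated (\<lambda>x. f' x (axis j 1))"
      using flat_generated_deriv[OF gen] by blast
    have "partial i f = (\<lambda>x. f' x (axis i 1))"
      by (rule ext) (rule partial_eqI[OF f'(1)])
    then show "flat_generated (partial i f)" using f'(2) by simp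
    show "\<And>x. f differentiable at x" using f'(1) by (rule differentiableI)
  qed
  have "flat_generated (foldr partial is f)" for "is"
    by (induction "is") (simp_all add: assms step)
  then show ?thesis unfolding smooth_def by (simp add: step)
qed

text \<open>As \<open>n\<close> grows, the factors \<open>exp (- 1 / ((n + 1) s))\<close>, \<open>s > 0\<close>, tend to \<open>1\<close>.\<close>

definition box_bump :: "point \<Rightarrow> point \<Rightarrow> nat \<Rightarrow> point \<Rightarrow> real" where
  "box_bump a b n x = (\<Prod>i\<in>UNIV. flat_exp 1 (real (Suc n) * (x $ i - a $ i)) *
     flat_exp 1 (real (Suc n) * (b $ i - x $ i)))"

lemma smooth_box_bump: "smooth (box_bump a b n)"
proof -
  have "flat_generated (\<lambda>x. flat_exp 1 (real (Suc n) * (x $ i - a $ i)) *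
     flat_exp 1 (real (Suc n) * (b $ i - x $ i)))" for i
    using flat_generated.mult[OF
        flat_generated.flat[of 1 "real (Suc n)" i "- (real (Suc n) * a $ i)"]
        flat_generated.flat[of 1 "- real (Suc n)" i "real (Suc n) * b $ i"]]
    by (simp add: algebra_simps)
  then show ?thesis
    unfolding box_bump_def[abs_def] UNIV_3
    by (intro smooth_flat_generated) (simp add: flat_generated.mult)
qed

lemma box_bump_eq_0: "x \<notin> box a b \<Longrightarrow> box_bump a b n x = 0"
  by (fastforce simp: box_bump_def mem_box_cart flat_exp_def zero_less_mult_iff)

lemma test_fun_box_bump:
  assumes "cbox a b \<subseteq> U"
  shows "test_fun U (box_bump a b n)"
proof -
  have sub: "closure {x. box_bump a b n x \<noteq> 0} \<subseteq> cbox a b"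
    using box_bump_eq_0 box_subset_cbox by (intro closure_minimal closed_cbox) blast
  then have "bounded (closure {x. box_bump a b n x \<noteq> 0})"
    by (rule bounded_subset[OF bounded_cbox])
  then show ?thesis
    using sub assms unfolding test_fun_def
    by (simp add: compact_eq_bounded_closed smooth_box_bump)
qed

lemma flat_exp_1_bounds: "0 \<le> flat_exp 1 s" "flat_exp 1 s \<le> 1"
  by (auto simp: flat_exp_def)

lemma box_bump_bounds: "0 \<le> box_bump a b n x" "box_bump a b n x \<le> 1"
  unfolding box_bump_def
  by (auto intro!: prod_nonneg prod_le_1 mult_nonneg_nonneg mult_le_one simp: flat_exp_1_bounds)

lemma flat_exp_scale_tendsto:
  "(\<lambda>n. flat_exp 1 (real (Suc n) * s)) \<longlonglongrightarrow> (if 0 < s then 1 else 0)"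
proof (cases "0 < s")
  case True
  have "(\<lambda>n. exp (- (inverse (real (Suc n)) / s))) \<longlonglongrightarrow> exp (- (0 / s))"
    using True by (intro tendsto_intros LIMSEQ_inverse_real_of_nat) auto
  moreover have "exp (- (inverse (real (Suc n)) / s)) = flat_exp 1 (real (Suc n) * s)" for n
    using True by (simp add: flat_exp_def field_simps zero_less_mult_iff del: of_nat_Suc)
  ultimately show ?thesis using True by simp
next
  case False
  then have "flat_exp 1 (real (Suc n) * s) = 0" for n
    by (simp add: flat_exp_def zero_less_mult_iff)
  then show ?thesis using False by simp
qed

lemma box_bump_tendsto: "(\<lambda>n. box_bump a b n x) \<longlonglongrightarrow> indicator (box a b) x"
proof -
  have "(\<lambda>n. box_bump a b n x) \<longlonglongrightarrow>
      (\<Prod>i\<in>UNIV. (if 0 < x $ i - a $ i then 1 else 0) * (if 0 < b $ i - x $ i then 1 else 0))"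
    unfolding box_bump_def by (intro tendsto_intros tendsto_prod tendsto_mult flat_exp_scale_tendsto)
  also have "(\<Prod>i\<in>UNIV. (if 0 < x $ i - a $ i then 1 else 0) * (if 0 < b $ i - x $ i then 1 else 0))
      = (indicator (box a b) x :: real)"
    proof (cases "x \<in> box a b")
    case False
    then obtain i where "\<not> (a $ i < x $ i \<and> x $ i < b $ i)" by (auto simp: mem_box_cart)
    then show ?thesis
      using False by (intro trans[OF prod_zero]) auto
  qed (auto simp: mem_box_cart)
  finally show ?thesis .
qed

text \<open>Open boxes form an intersection-stable generator of the Borel sets, and the sets over
  which \<open>g\<close> integrates to 0 form a Dynkin system. The whole space is not a box, so
  \<open>total\<close> supplies the step to complements. A density whose integrals over all Borel
  sets vanish agrees with the density 0 almost everywhere.\<close>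

lemma AE_eq_0_of_box_integrals:
  fixes g :: "point \<Rightarrow> real"
  assumes g: "integrable lborel g" and box: "\<And>a b. (LINT x:box a b|lborel. g x) = 0"
    and total: "(LINT x|lborel. g x) = 0"
  shows "AE x in lborel. g x = 0"
proof -
  have si: "set_integrable lborel A g" if "A \<in> sets borel" for A
    using integrable_mult_indicator[OF _ g] that by (simp add: set_integrable_def)
  have "(LINT x:A|lborel. g x) = 0" if A: "A \<in> sets borel" for A
  proof -
    have "Int_stable (range (\<lambda>(a, b). box a b :: point set))"
      by (auto simp: Int_stable_def box_Int_box)
    moreover have "range (\<lambda>(a, b). box a b :: point set) \<subseteq> Pow UNIV"
      by auto
    moreover have "A \<in> sigma_sets UNIV (range (\<lambda>(a, b). box a b :: point set))"
      using A unfolding borel_eq_box by simp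
    ultimately show ?thesis
    proof (induction rule: sigma_sets_induct_disjoint)
      case (basic A)
      then show ?case by (auto simp: box)
    next
      case empty
      then show ?case by (simp add: set_lebesgue_integral_def)
    next
      case (compl A)
      then have A: "A \<in> sets borel" by (simp add: borel_eq_box)
      have "(LINT x:A|lborel. g x) + (LINT x:UNIV - A|lborel. g x) = (LINT x:A \<union> (UNIV - A)|lborel. g x)"
        by (rule set_integral_Un[symmetric]) (use A si in auto)
      also have "\<dots> = 0" using total by (simp add: set_lebesgue_integral_def)
      finally show ?case using compl by simp
    next
      case (union F)
      then have F: "\<And>i. F i \<in> sets borel" by (simp add: borel_eq_box subset_eq)
      have "(LINT x:(\<Union>i. F i)|lborel. g x) = (\<Sum>i. (LINT x:F i|lborel. g x))"
        by (rule lebesgue_integral_countable_add)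
          (use F si union in \<open>auto simp: disjoint_family_on_def\<close>)
      then show ?case using union by simp
    qed
  qed
  then show ?thesis
    using g by (intro density_unique_real) (auto simp: set_lebesgue_integral_def)
qed

text \<open>The bumps of a box with closure in \<open>U\<close> are test functions, bounded by 1 and
  convergent to the indicator of the open box; dominated convergence makes the integral of
  \<open>f\<close> over that box 0. Inside one fixed such box this determines \<open>f\<close>,
  since subboxes are again admissible. Countably many closed boxes exhaust \<open>U\<close>, and
  their frontiers are null sets.\<close>

lemma AE_eq_0_of_test_funs:
  fixes f :: "point \<Rightarrow> real"
  assumes U: "open U" and f: "square_integrable f"
    and 0: "\<And>\<psi>. test_fun U \<psi> \<Longrightarrow> (LINT x|lebesgue. f x * \<psi> x) = 0"
  shows "AE x in lebesgue. x \<in> U \<longrightarrow> f x = 0"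
proof -
  have f_meas[measurable]: "f \<in> borel_measurable lebesgue"
    using f by (simp add: square_integrable_def)
  have int_box: "integrable lebesgue (\<lambda>x. indicator (box a b) x * f x)" for a b
  proof (rule Bochner_Integration.integrable_bound)
    show "integrable lebesgue (\<lambda>x. indicator (box a b) x + (norm (f x))\<^sup>2)"
    proof (rule Bochner_Integration.integrable_add)
      show "integrable lebesgue (indicator (box a b) :: point \<Rightarrow> real)"
        using emeasure_bounded_finite[OF bounded_box, of a b] by (intro integrable_real_indicator) simp_all
      show "integrable lebesgue (\<lambda>x. (norm (f x))\<^sup>2)" using f by (simp add: square_integrable_def)
    qed
    \<comment> \<open>On a set of finite measure, square integrability implies
      integrability.\<close>
    have "\<bar>y\<bar> \<le> 1 + y\<^sup>2" for y :: real
      using zero_le_power2[of "\<bar>y\<bar> - 1"] by (auto simp: power2_eq_square algebra_simps abs_if)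
    then show "AE x in lebesgue. norm (indicator (box a b) x * f x)
        \<le> norm (indicator (box a b) x + (norm (f x))\<^sup>2)"
      by (auto simp: indicator_def intro!: AE_I2)
    show "(\<lambda>x. indicator (box a b) x * f x) \<in> borel_measurable lebesgue"
      by (intro borel_measurable_times borel_measurable_indicator f_meas) simp
  qed
  have box0: "(LINT x|lebesgue. indicator (box a b) x * f x) = 0" if "cbox a b \<subseteq> U" for a b
  proof -
    have "(\<lambda>n. LINT x|lebesgue. f x * box_bump a b n x) \<longlonglongrightarrow>
        (LINT x|lebesgue. indicator (box a b) x * f x)"
    proof (rule integral_dominated_convergence)
      show "integrable lebesgue (\<lambda>x. norm (indicator (box a b) x * f x))"
        by (intro integrable_norm int_box)
      show "AE x in lebesgue. (\<lambda>n. f x * box_bump a b n x) \<longlonglongrightarrow> indicator (box a b) x * f x"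
        using tendsto_mult[OF tendsto_const box_bump_tendsto] by (auto simp: mult.commute)
      show "AE x in lebesgue. norm (f x * box_bump a b n x) \<le> norm (indicator (box a b) x * f x)" for n
      proof (rule AE_I2)
        fix x
        show "norm (f x * box_bump a b n x) \<le> norm (indicator (box a b) x * f x)"
          using box_bump_bounds[of a b n x] mult_left_le[of "box_bump a b n x" "\<bar>f x\<bar>"]
          by (cases "x \<in> box a b") (auto simp: box_bump_eq_0 abs_mult)
      qed
      have [measurable]: "box_bump a b n \<in> borel_measurable lebesgue" for n
        using test_fun_measurable[OF test_fun_box_bump[OF that]] by (intro measurable_completion) simp
      show "(\<lambda>x. f x * box_bump a b n x) \<in> borel_measurable lebesgue" for n by measurable
    qed (intro borel_measurable_times borel_measurable_indicator f_meas, simp)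
    then show ?thesis
      by (simp add: 0[OF test_fun_box_bump[OF that]] LIMSEQ_const_iff)
  qed
  have on_box: "AE x in lebesgue. x \<in> box c d \<longrightarrow> f x = 0" if cd: "cbox c d \<subseteq> U" for c d
  proof -
    \<comment> \<open>\<open>f\<close> is only Lebesgue measurable, whereas the generator argument
      takes place on Borel sets; it is applied to a Borel representative of \<open>f\<close> cut off
      to the box.\<close>
    obtain g where g: "g \<in> borel_measurable lborel" "AE x in lborel. indicator (box c d) x * f x = g x"
      using completion_ex_borel_measurable_real[OF borel_measurable_integrable[OF int_box[of c d]]] by auto
    have g_ae: "AE x in lebesgue. indicator (box c d) x * f x = g x" using g(2) by (rule AE_completion)
    have g_leb: "g \<in> borel_measurable lebesgue" using g(1) by (rule measurable_completion)
    have "integrable lebesgue g"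
      using int_box[of c d] g_ae g_leb by (subst integrable_cong_AE[symmetric]) auto
    then have g_int: "integrable lborel g" using g(1) by (simp add: integrable_completion)
    have transfer: "(LINT x|lborel. indicator A x * g x) = (LINT x|lebesgue. indicator (A \<inter> box c d) x * f x)"
      if "A \<in> sets borel" for A
    proof -
      have "(LINT x|lborel. indicator A x * g x) = (LINT x|lebesgue. indicator A x * g x)"
        using g(1) that
        by (intro integral_completion[symmetric] borel_measurable_times borel_measurable_indicator) simp_all
      also have "\<dots> = (LINT x|lebesgue. indicator (A \<inter> box c d) x * f x)"
      proof (rule integral_cong_AE)
        have [measurable]: "A \<in> sets lebesgue" "box c d \<in> sets lebesgue" using that by auto
        show "(\<lambda>x. indicator A x * g x) \<in> borel_measurable lebesgue"
          using g_leb by measurable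
        show "(\<lambda>x. indicator (A \<inter> box c d) x * f x) \<in> borel_measurable lebesgue" by measurable
        show "AE x in lebesgue. indicator A x * g x = indicator (A \<inter> box c d) x * f x"
          using g_ae by eventually_elim (auto simp: indicator_def split: if_splits)
      qed
      finally show ?thesis .
    qed
    have "AE x in lborel. g x = 0"
    proof (rule AE_eq_0_of_box_integrals[OF g_int])
      show "(LINT x|lborel. g x) = 0"
        using transfer[of UNIV] box0[OF cd] by simp
      fix a b
      obtain a' b' where ab: "box a b \<inter> box c d = box a' b'" using box_Int_box[of a b c d] by blast
      have "(LINT x|lebesgue. indicator (box a' b') x * f x) = 0"
      \<comment> \<open>For an empty open box the closed box with the same corners need not be
        empty, nor contained in \<open>U\<close>; only a nonempty open box has
        \<open>cbox a' b'\<close> as its closure.\<close>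
      proof (cases "box a' b' = {}")
        case False
        have "cbox a' b' \<subseteq> cbox c d"
          unfolding closure_box[OF False, symmetric] ab[symmetric]
          by (intro closure_minimal closed_cbox) (use box_subset_cbox in blast)
        then show ?thesis using cd by (intro box0) blast
      qed simp
      then show "(LINT x:box a b|lborel. g x) = 0"
        using transfer[of "box a b"] by (simp add: set_lebesgue_integral_def ab)
    qed
    then have "AE x in lebesgue. g x = 0" by (rule AE_completion)
    with g_ae show ?thesis by eventually_elim (auto simp: indicator_def)
  qed
  obtain \<D> where \<D>: "countable \<D>" "\<D> \<subseteq> Pow U" "\<And>X. X \<in> \<D> \<Longrightarrow> \<exists>a b. X = cbox a b" "\<Union>\<D> = U"
    by (rule open_countable_Union_open_cbox[OF U], rule that) simp_all
  have "AE x in lebesgue. x \<in> X \<longrightarrow> f x = 0" if X\<D>: "X \<in> \<D>" for X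
  proof -
    obtain a b where X: "X = cbox a b" using \<D>(3)[OF X\<D>] by auto
    have sub: "cbox a b \<subseteq> U" using \<D>(2) X\<D> unfolding X by auto
    have "AE x in lebesgue. x \<notin> frontier (cbox a b)"
      using negligible_convex_frontier[of "cbox a b"]
      by (intro AE_not_in) (simp add: negligible_iff_null_sets)
    with on_box[OF sub] show ?thesis
      by eventually_elim (auto simp: X frontier_cbox)
  qed
  then have "AE x in lebesgue. \<forall>X\<in>\<D>. x \<in> X \<longrightarrow> f x = 0"
    unfolding AE_ball_countable[OF \<D>(1)] by blast
  then show ?thesis unfolding \<D>(4)[symmetric] by eventually_elim auto
qed

section \<open>Weak derivatives as identities of inner products\<close>

lemma L2_eq_rep: "L2_eq (rep_L2 u) (rep_L2 u)"
  by (rule Quotient_rep_reflp[OF Quotient_L2])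

lemma abs_rep_L2: "abs_L2 (rep_L2 u) = u"
  by (rule Quotient_abs_rep[OF Quotient_L2])

lemma square_integrable_rep: "square_integrable (rep_L2 u)"
  using L2_eq_rep by (simp add: L2_eq_def)

lemma measurable_rep [measurable]: "rep_L2 u \<in> borel_measurable lebesgue"
  using square_integrable_rep[of u] by (simp add: square_integrable_def)

lemma L2_eqI:
  assumes "AE x in lebesgue. rep_L2 u x = rep_L2 v x"
  shows "u = v"
  using assms square_integrable_rep[of u] square_integrable_rep[of v]
  by (intro iffD1[OF Quotient_rel_rep[OF Quotient_L2]]) (simp add: L2_eq_def)

lemma rep_abs_L2:
  assumes "square_integrable f"
  shows "AE x in lebesgue. rep_L2 (abs_L2 f) x = f x"
proof -
  have "L2_eq (rep_L2 (abs_L2 f)) f"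
    using assms by (intro Quotient_rep_abs[OF Quotient_L2]) (simp add: L2_eq_def)
  then show ?thesis by (simp add: L2_eq_def)
qed

lemma rep_zero_L2: "AE x in lebesgue. rep_L2 (0 :: 'b::euclidean_space L2) x = 0"
  unfolding zero_L2_def by (rule rep_abs_L2[OF square_integrable_zero])

lemma rep_add_L2: "AE x in lebesgue. rep_L2 (u + v) x = rep_L2 u x + rep_L2 v x"
proof -
  have "u + v = abs_L2 (\<lambda>x. rep_L2 u x + rep_L2 v x)"
    using plus_L2.abs_eq[OF L2_eq_rep L2_eq_rep, of u v] by (simp add: abs_rep_L2)
  then show ?thesis
    using rep_abs_L2[OF square_integrable_add[OF square_integrable_rep square_integrable_rep]] by metis
qed

lemma rep_scaleR_L2: "AE x in lebesgue. rep_L2 (c *\<^sub>R u) x = c *\<^sub>R rep_L2 u x"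
proof -
  have "c *\<^sub>R u = abs_L2 (\<lambda>x. c *\<^sub>R rep_L2 u x)"
    using scaleR_L2.abs_eq[OF L2_eq_rep, of c u] by (simp add: abs_rep_L2)
  then show ?thesis
    using rep_abs_L2[OF square_integrable_scaleR[OF square_integrable_rep]] by metis
qed

lemma inner_L2_rep: "u \<bullet> v = (LINT x|lebesgue. rep_L2 u x \<bullet> rep_L2 v x)"
  using inner_L2.abs_eq[OF L2_eq_rep L2_eq_rep, of u v] by (simp add: abs_rep_L2)

lemma inner_abs_L2:
  assumes "square_integrable f"
  shows "u \<bullet> abs_L2 f = (LINT x|lebesgue. rep_L2 u x \<bullet> f x)"
  unfolding inner_L2_rep
proof (rule integral_cong_AE)
  have [measurable]: "f \<in> borel_measurable lebesgue"
    using assms by (simp add: square_integrable_def)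
  show "(\<lambda>x. rep_L2 u x \<bullet> f x) \<in> borel_measurable lebesgue" by measurable
  show "AE x in lebesgue. rep_L2 u x \<bullet> rep_L2 (abs_L2 f) x = rep_L2 u x \<bullet> f x"
    using rep_abs_L2[OF assms] by eventually_elim simp
qed measurable

text \<open>A function vanishing off \<open>U\<close> makes the integral over \<open>U\<close> one
  over the whole space. The defining identities of weak derivatives thereby become inner products
  with fixed elements, which are continuous linear in the field.\<close>

lemma set_integral_rep_inner:
  assumes "square_integrable f" "\<And>x. x \<notin> U \<Longrightarrow> f x = 0"
  shows "(LINT x:U|lebesgue. rep_L2 u x \<bullet> f x) = u \<bullet> abs_L2 f"
proof -
  have "indicator U x *\<^sub>R (rep_L2 u x \<bullet> f x) = rep_L2 u x \<bullet> f x" for x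
    using assms(2)[of x] by (cases "x \<in> U") simp_all
  then show ?thesis by (simp only: set_lebesgue_integral_def inner_abs_L2[OF assms(1)])
qed

section \<open>Restriction to a set\<close>

lemma square_integrable_indicator:
  assumes S: "S \<in> sets lebesgue" and f: "square_integrable f"
  shows "square_integrable (\<lambda>x. indicator S x *\<^sub>R f x)"
proof -
  have m: "f \<in> borel_measurable lebesgue" using f by (simp add: square_integrable_def)
  have "integrable lebesgue (\<lambda>x. indicator S x *\<^sub>R (norm (f x))\<^sup>2)"
    using f by (intro integrable_mult_indicator[OF S]) (simp add: square_integrable_def)
  moreover have "indicator S x *\<^sub>R (norm (f x))\<^sup>2 = (norm (indicator S x *\<^sub>R f x))\<^sup>2" for x
    by (simp add: indicator_def)
  ultimately show ?thesis
    using m S unfolding square_integrable_def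
    by (auto intro!: borel_measurable_scaleR borel_measurable_indicator)
qed

lemma rep_restr:
  assumes "S \<in> sets lebesgue"
  shows "AE x in lebesgue. rep_L2 (restr S u) x = indicator S x *\<^sub>R rep_L2 u x"
  unfolding restr_def by (intro rep_abs_L2 square_integrable_indicator assms square_integrable_rep)

text \<open>Moving the cutoff onto one factor turns an integral over an element into a Hilbert space
  inner product, so that elementwise pairings of curves can be differentiated in time.\<close>

lemma ip_eq_restr_right:
  assumes "S \<in> sets lebesgue"
  shows "ip S u v = u \<bullet> restr S v"
  unfolding restr_def
  by (simp add: ip_def inner_abs_L2 square_integrable_indicator assms square_integrable_rep
      set_lebesgue_integral_def)

lemma ip_commute: "ip S u v = ip S v u"
  by (simp add: ip_def inner_commute)

lemma ip_eq_restr_left: "S \<in> sets lebesgue \<Longrightarrow> ip S u v = restr S u \<bullet> v"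
  by (metis ip_commute ip_eq_restr_right inner_commute)

lemma ip_zero_left: "S \<in> sets lebesgue \<Longrightarrow> ip S 0 v = 0"
  by (simp add: ip_eq_restr_right)

lemma restr_add:
  assumes "S \<in> sets lebesgue"
  shows "restr S (u + v) = restr S u + restr S v"
proof (rule L2_eqI)
  show "AE x in lebesgue. rep_L2 (restr S (u + v)) x = rep_L2 (restr S u + restr S v) x"
    using rep_restr[OF assms, of "u + v"] rep_restr[OF assms, of u] rep_restr[OF assms, of v]
      rep_add_L2[of u v] rep_add_L2[of "restr S u" "restr S v"]
    by eventually_elim (simp add: scaleR_add_right)
qed

lemma restr_scaleR:
  assumes "S \<in> sets lebesgue"
  shows "restr S (c *\<^sub>R u) = c *\<^sub>R restr S u"
proof (rule L2_eqI)
  show "AE x in lebesgue. rep_L2 (restr S (c *\<^sub>R u)) x = rep_L2 (c *\<^sub>R restr S u) x"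
    using rep_restr[OF assms, of "c *\<^sub>R u"] rep_restr[OF assms, of u]
      rep_scaleR_L2[of c u] rep_scaleR_L2[of c "restr S u"]
    by eventually_elim simp
qed

text \<open>Being supported in \<open>S\<close> is being a fixed point of the linear map
  \<open>restr S\<close>; the subspace property of \<open>L2_on S\<close> is read off from
  this.\<close>

lemma L2_on_iff_restr:
  assumes "S \<in> sets lebesgue"
  shows "u \<in> L2_on S \<longleftrightarrow> restr S u = u"
proof
  assume "u \<in> L2_on S"
  then have "AE x in lebesgue. x \<notin> S \<longrightarrow> rep_L2 u x = 0" by (simp add: L2_on_def)
  with rep_restr[OF assms, of u]
  have "AE x in lebesgue. rep_L2 (restr S u) x = rep_L2 u x"
    by eventually_elim (auto simp: indicator_def)
  then show "restr S u = u" by (rule L2_eqI)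
next
  assume *: "restr S u = u"
  have "AE x in lebesgue. rep_L2 u x = indicator S x *\<^sub>R rep_L2 u x"
    using rep_restr[OF assms, of u] unfolding * .
  then show "u \<in> L2_on S"
    unfolding L2_on_def by (simp, eventually_elim, auto simp: indicator_def)
qed

lemma restr_in_L2_on:
  assumes "S \<in> sets lebesgue"
  shows "restr S u \<in> L2_on S"
  unfolding L2_on_def using rep_restr[OF assms, of u]
  by (simp, eventually_elim, auto simp: indicator_def)

lemma subspace_L2_on:
  assumes "S \<in> sets lebesgue"
  shows "subspace (L2_on S)"
  unfolding subspace_def
  by (auto simp: L2_on_iff_restr assms restr_add restr_scaleR)
    (metis assms restr_scaleR scaleR_zero_left)

lemma restr_abs_L2:
  assumes S: "S \<in> sets lebesgue" and f: "square_integrable f" and 0: "\<And>x. x \<notin> S \<Longrightarrow> f x = 0"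
  shows "restr S (abs_L2 f) = abs_L2 f"
proof -
  have "AE x in lebesgue. x \<notin> S \<longrightarrow> rep_L2 (abs_L2 f) x = 0"
    using rep_abs_L2[OF f] by eventually_elim (simp add: 0)
  then show ?thesis by (simp add: L2_on_iff_restr[OF S, symmetric] L2_on_def)
qed

section \<open>Test fields and their classical derivatives\<close>

lemma square_integrable_bound:
  assumes f: "f \<in> borel_measurable lebesgue" and g: "square_integrable g"
    and le: "\<And>x. norm (f x) \<le> norm (g x)"
  shows "square_integrable f"
proof -
  have "integrable lebesgue (\<lambda>x. (norm (f x))\<^sup>2)"
  proof (rule Bochner_Integration.integrable_bound)
    show "integrable lebesgue (\<lambda>x. (norm (g x))\<^sup>2)" using g by (simp add: square_integrable_def)
    show "(\<lambda>x. (norm (f x))\<^sup>2) \<in> borel_measurable lebesgue" using f by measurable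
  qed (simp add: le power_mono)
  with f show ?thesis by (simp add: square_integrable_def)
qed

lemma square_integrable_components:
  fixes f :: "point \<Rightarrow> real^3"
  assumes "\<And>i. square_integrable (\<lambda>x. f x $ i)"
  shows "square_integrable f"
proof -
  have "square_integrable (\<lambda>x. f x $ 1 *\<^sub>R (axis 1 1 :: real^3) + f x $ 2 *\<^sub>R axis 2 1 + f x $ 3 *\<^sub>R axis 3 1)"
  proof -
    have "square_integrable (\<lambda>x. f x $ i *\<^sub>R (axis i 1 :: real^3))" for i
    proof (rule square_integrable_bound[OF _ assms[of i]])
      have "(\<lambda>x. f x $ i) \<in> borel_measurable lebesgue"
        using assms[of i] by (simp add: square_integrable_def)
      then show "(\<lambda>x. f x $ i *\<^sub>R (axis i 1 :: real^3)) \<in> borel_measurable lebesgue" by measurable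
    qed simp
    then show ?thesis by (intro square_integrable_add)
  qed
  moreover have "(\<lambda>x. f x $ 1 *\<^sub>R (axis 1 1 :: real^3) + f x $ 2 *\<^sub>R axis 2 1 + f x $ 3 *\<^sub>R axis 3 1) = f"
    by (auto simp: vec_eq_iff axis_def fun_eq_iff forall_3)
  ultimately show ?thesis by simp
qed

lemma test_field_square_integrable: "test_field U \<Psi> \<Longrightarrow> square_integrable \<Psi>"
  by (rule square_integrable_components) (auto simp: test_field_def intro: square_integrable_test_fun)

lemma test_field_eq_0: "test_field U \<Psi> \<Longrightarrow> x \<notin> U \<Longrightarrow> \<Psi> x = 0"
  unfolding vec_eq_iff test_field_def by (metis test_fun_eq_0 zero_index)

lemma test_field_mono: "test_field U \<Psi> \<Longrightarrow> U \<subseteq> V \<Longrightarrow> test_field V \<Psi>"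
  unfolding test_field_def by (blast intro: test_fun_mono)

lemma test_field_grad: "test_fun U \<psi> \<Longrightarrow> test_field U (classical_grad \<psi>)"
  by (simp add: test_field_def classical_grad_def test_fun_partial)

lemma test_field_curl:
  assumes "test_field U \<Psi>"
  shows "test_field U (classical_curl \<Psi>)"
  unfolding test_field_def forall_3 classical_curl_def vector_3
  using assms by (intro conjI test_fun_diff test_fun_partial) (simp_all add: test_field_def)

lemma test_fun_div:
  assumes "test_field U \<Psi>"
  shows "test_fun U (classical_div \<Psi>)"
proof -
  have "test_fun U (partial i (\<lambda>y. \<Psi> y $ i))" for i
    using assms by (simp add: test_field_def test_fun_partial)
  \<comment> \<open>The sum of the three partial derivatives is written with differences only,
    because closure under differences and the zero function are what is available.\<close>
  then have "test_fun U (\<lambda>x. partial 1 (\<lambda>y. \<Psi> y $ 1) x -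
      (0 - partial 2 (\<lambda>y. \<Psi> y $ 2) x - partial 3 (\<lambda>y. \<Psi> y $ 3) x))"
    by (intro test_fun_diff test_fun_zero)
  moreover have "classical_div \<Psi> = (\<lambda>x. partial 1 (\<lambda>y. \<Psi> y $ 1) x -
      (0 - partial 2 (\<lambda>y. \<Psi> y $ 2) x - partial 3 (\<lambda>y. \<Psi> y $ 3) x))"
    by (simp add: fun_eq_iff classical_div_def sum_3)
  ultimately show ?thesis by simp
qed

lemma classical_curl_grad:
  assumes "smooth \<psi>"
  shows "classical_curl (classical_grad \<psi>) = (\<lambda>x. 0)"
  by (simp add: fun_eq_iff classical_curl_def classical_grad_def vec_eq_iff forall_3
      partial_commute[OF assms, of 2 1] partial_commute[OF assms, of 3 1] partial_commute[OF assms, of 3 2])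

lemma classical_div_curl:
  assumes "\<And>i. smooth (\<lambda>x. \<Psi> x $ i)"
  shows "classical_div (classical_curl \<Psi>) = (\<lambda>x. 0)"
proof (rule ext)
  fix x
  have d: "partial i (partial j (\<lambda>y. \<Psi> y $ k)) differentiable at x"
    "partial j (\<lambda>y. \<Psi> y $ k) differentiable at x" for i j k x
    using assms by (simp_all add: smooth_differentiable smooth_partial)
  show "classical_div (classical_curl \<Psi>) x = 0"
    by (simp add: classical_div_def classical_curl_def sum_3 partial_diff d
        partial_commute[OF assms, of 2 1] partial_commute[OF assms, of 3 1] partial_commute[OF assms, of 3 2])
qed

section \<open>Weak derivatives: characterisation, composition, restriction\<close>

lemma weak_grad_iff:
  "weak_grad U \<phi> g \<longleftrightarrow> (\<forall>\<Psi>. test_field U \<Psi> \<longrightarrow> g \<bullet> abs_L2 \<Psi> = - (\<phi> \<bullet> abs_L2 (classical_div \<Psi>)))"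
proof -
  have "(LINT x:U|lebesgue. rep_L2 g x \<bullet> \<Psi> x) = g \<bullet> abs_L2 \<Psi>"
    "(LINT x:U|lebesgue. rep_L2 \<phi> x * classical_div \<Psi> x) = \<phi> \<bullet> abs_L2 (classical_div \<Psi>)"
    if "test_field U \<Psi>" for \<Psi>
    using that test_fun_div[OF that] set_integral_rep_inner[of "classical_div \<Psi>" U \<phi>]
    by (auto intro!: set_integral_rep_inner
        simp: test_field_square_integrable square_integrable_test_fun test_field_eq_0 test_fun_eq_0)
  then show ?thesis unfolding weak_grad_def by auto
qed

lemma weak_curl_iff:
  "weak_curl U u w \<longleftrightarrow> (\<forall>\<Psi>. test_field U \<Psi> \<longrightarrow> w \<bullet> abs_L2 \<Psi> = u \<bullet> abs_L2 (classical_curl \<Psi>))"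
proof -
  have "(LINT x:U|lebesgue. rep_L2 w x \<bullet> \<Psi> x) = w \<bullet> abs_L2 \<Psi>"
    "(LINT x:U|lebesgue. rep_L2 u x \<bullet> classical_curl \<Psi> x) = u \<bullet> abs_L2 (classical_curl \<Psi>)"
    if "test_field U \<Psi>" for \<Psi>
    using that test_field_curl[OF that]
    by (auto intro!: set_integral_rep_inner simp: test_field_square_integrable test_field_eq_0)
  then show ?thesis unfolding weak_curl_def by auto
qed

lemma weak_div_iff:
  "weak_div U u d \<longleftrightarrow> (\<forall>\<psi>. test_fun U \<psi> \<longrightarrow> d \<bullet> abs_L2 \<psi> = - (u \<bullet> abs_L2 (classical_grad \<psi>)))"
proof -
  have "(LINT x:U|lebesgue. rep_L2 d x * \<psi> x) = d \<bullet> abs_L2 \<psi>"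
    "(LINT x:U|lebesgue. rep_L2 u x \<bullet> classical_grad \<psi> x) = u \<bullet> abs_L2 (classical_grad \<psi>)"
    if "test_fun U \<psi>" for \<psi>
    using that test_field_grad[OF that] set_integral_rep_inner[of \<psi> U d]
    by (auto intro!: set_integral_rep_inner
        simp: test_field_square_integrable square_integrable_test_fun test_field_eq_0 test_fun_eq_0)
  then show ?thesis unfolding weak_div_def by auto
qed

text \<open>The curl of a test field is again a test field, so it may be inserted into the
  definition of the weak gradient, where its classical divergence vanishes.\<close>

lemma weak_curl_grad:
  assumes "weak_grad U \<phi> g"
  shows "weak_curl U g 0"
  unfolding weak_curl_iff
proof (intro allI impI)
  fix \<Psi> assume \<Psi>: "test_field U \<Psi>"
  have "g \<bullet> abs_L2 (classical_curl \<Psi>) = - (\<phi> \<bullet> abs_L2 (classical_div (classical_curl \<Psi>)))"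
    using assms test_field_curl[OF \<Psi>] by (simp add: weak_grad_iff)
  also have "classical_div (classical_curl \<Psi>) = (\<lambda>x. 0)"
    using \<Psi> by (intro classical_div_curl) (simp add: test_field_def test_fun_def)
  finally show "0 \<bullet> abs_L2 \<Psi> = g \<bullet> abs_L2 (classical_curl \<Psi>)"
    by (simp add: zero_L2_def[symmetric])
qed

text \<open>Dual to the previous lemma: the weak curl is tested with the gradient of a test
  function, whose classical curl vanishes.\<close>

lemma weak_div_curl:
  assumes "weak_curl U u w"
  shows "weak_div U w 0"
  unfolding weak_div_iff
proof (intro allI impI)
  fix \<psi> assume \<psi>: "test_fun U \<psi>"
  have "w \<bullet> abs_L2 (classical_grad \<psi>) = u \<bullet> abs_L2 (classical_curl (classical_grad \<psi>))"
    using assms test_field_grad[OF \<psi>] by (simp add: weak_curl_iff)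
  then show "0 \<bullet> abs_L2 \<psi> = - (w \<bullet> abs_L2 (classical_grad \<psi>))"
    using \<psi> by (simp add: classical_curl_grad test_fun_def zero_L2_def[symmetric])
qed

text \<open>A test field on the interior of \<open>K\<close> is one on \<open>U\<close>, and pairing
  with it does not see the cutoff to \<open>K\<close>. Thus a global weak curl induces the
  elementwise one, with no boundary contribution.\<close>

lemma weak_curl_restr:
  assumes K: "K \<in> sets lebesgue" "interior K \<subseteq> U" and w: "weak_curl U u w"
  shows "weak_curl (interior K) (restr K u) (restr K w)"
  unfolding weak_curl_iff
proof (intro allI impI)
  fix \<Psi> assume \<Psi>: "test_field (interior K) \<Psi>"
  have supp: "restr K v \<bullet> abs_L2 \<Phi> = v \<bullet> abs_L2 \<Phi>" if "test_field (interior K) \<Phi>" for v \<Phi>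
    using that interior_subset[of K]
    by (metis K(1) ip_eq_restr_left ip_eq_restr_right restr_abs_L2 subsetD
        test_field_eq_0 test_field_square_integrable)
  show "restr K w \<bullet> abs_L2 \<Psi> = restr K u \<bullet> abs_L2 (classical_curl \<Psi>)"
    using w test_field_mono[OF \<Psi> K(2)]
    by (simp add: supp \<Psi> test_field_curl weak_curl_iff)
qed

lemma weak_div_restr:
  assumes K: "K \<in> sets lebesgue" "interior K \<subseteq> U" and d: "weak_div U u d"
  shows "weak_div (interior K) (restr K u) (restr K d)"
  unfolding weak_div_iff
proof (intro allI impI)
  fix \<psi> assume \<psi>: "test_fun (interior K) \<psi>"
  have supp: "restr K v \<bullet> abs_L2 f = v \<bullet> abs_L2 f"
    if "square_integrable f" "\<And>x. x \<notin> interior K \<Longrightarrow> f x = 0"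
    for v :: "'b::euclidean_space L2" and f
    using that interior_subset[of K]
    by (metis K(1) ip_eq_restr_left ip_eq_restr_right restr_abs_L2 subsetD)
  show "restr K d \<bullet> abs_L2 \<psi> = - (restr K u \<bullet> abs_L2 (classical_grad \<psi>))"
    using d test_fun_mono[OF \<psi> K(2)] test_field_grad[OF \<psi>] \<psi>
    by (simp add: supp weak_div_iff square_integrable_test_fun test_field_square_integrable
        test_fun_eq_0 test_field_eq_0)
qed

section \<open>Uniqueness of weak derivatives\<close>

lemma AE_eq_0_off_null_boundary:
  assumes "negligible (S - interior S)"
    and "AE x in lebesgue. x \<in> interior S \<longrightarrow> f x = 0" "AE x in lebesgue. x \<notin> S \<longrightarrow> f x = 0"
  shows "AE x in lebesgue. f x = 0"
proof -
  have "AE x in lebesgue. x \<notin> S - interior S"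
    using assms(1) by (intro AE_not_in) (simp add: negligible_iff_null_sets)
  with assms(2,3) show ?thesis by eventually_elim auto
qed

lemma L2_on_eq_0_scalar:
  fixes u :: "real L2"
  assumes S: "negligible (S - interior S)" and u: "u \<in> L2_on S"
    and 0: "\<And>\<psi>. test_fun (interior S) \<psi> \<Longrightarrow> u \<bullet> abs_L2 \<psi> = 0"
  shows "u = 0"
proof -
  have "AE x in lebesgue. x \<in> interior S \<longrightarrow> rep_L2 u x = 0"
    using 0 square_integrable_rep
    by (intro AE_eq_0_of_test_funs) (auto simp: inner_abs_L2 square_integrable_test_fun)
  then have "AE x in lebesgue. rep_L2 u x = 0"
    using u by (intro AE_eq_0_off_null_boundary[OF S]) (auto simp: L2_on_def)
  with rep_zero_L2 have "AE x in lebesgue. rep_L2 u x = rep_L2 0 x"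
    by eventually_elim simp
  then show ?thesis by (rule L2_eqI)
qed

lemma L2_on_eq_0_vector:
  fixes u :: "(real^3) L2"
  assumes S: "negligible (S - interior S)" and u: "u \<in> L2_on S"
    and 0: "\<And>\<Psi>. test_field (interior S) \<Psi> \<Longrightarrow> u \<bullet> abs_L2 \<Psi> = 0"
  shows "u = 0"
proof -
  have "AE x in lebesgue. x \<in> interior S \<longrightarrow> rep_L2 u x $ i = 0" for i
  proof (rule AE_eq_0_of_test_funs)
    show "square_integrable (\<lambda>x. rep_L2 u x $ i)"
    proof (rule square_integrable_bound[OF _ square_integrable_rep[of u]])
      have "(\<lambda>x. rep_L2 u x \<bullet> axis i 1) \<in> borel_measurable lebesgue" by measurable
      then show "(\<lambda>x. rep_L2 u x $ i) \<in> borel_measurable lebesgue" by (simp add: inner_axis)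
    qed (simp add: component_le_norm_cart)
    fix \<psi> assume \<psi>: "test_fun (interior S) \<psi>"
    \<comment> \<open>A test field with a single nonzero component isolates the i-th component of
      \<open>u\<close> and reduces the claim to the scalar fundamental lemma.\<close>
    have tf: "test_field (interior S) (\<lambda>x. \<psi> x *\<^sub>R axis i 1)"
      unfolding test_field_def
    proof
      show "test_fun (interior S) (\<lambda>x. (\<psi> x *\<^sub>R axis i 1) $ j)" for j
        using \<psi> by (cases "i = j") (simp_all add: axis_def test_fun_zero)
    qed
    show "(LINT x|lebesgue. rep_L2 u x $ i * \<psi> x) = 0"
      using 0[OF tf] by (simp add: inner_abs_L2 test_field_square_integrable[OF tf] inner_axis mult.commute)
  qed simp
  then have "AE x in lebesgue. x \<in> interior S \<longrightarrow> rep_L2 u x = 0"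
    by (simp add: vec_eq_iff AE_all_countable flip: all_simps(6))
  then have "AE x in lebesgue. rep_L2 u x = 0"
    using u by (intro AE_eq_0_off_null_boundary[OF S]) (auto simp: L2_on_def)
  with rep_zero_L2 have "AE x in lebesgue. rep_L2 u x = rep_L2 0 x"
    by eventually_elim simp
  then show ?thesis by (rule L2_eqI)
qed

text \<open>The property shared by the open domain and the closed tetrahedra: an element of
  \<open>L2_on S\<close> is determined by its values on the interior, which is all that test
  functions see.\<close>

definition null_boundary :: "point set \<Rightarrow> bool" where
  "null_boundary S \<longleftrightarrow> S \<in> sets lebesgue \<and> negligible (S - interior S)"

lemma null_boundary_open: "open S \<Longrightarrow> null_boundary S"
  by (simp add: null_boundary_def interior_open)

lemma null_boundary_closed_convex:
  assumes "closed S" "convex S"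
  shows "null_boundary S"
  unfolding null_boundary_def
proof
  have "S - interior S = frontier S" using assms(1) by (simp add: frontier_def closure_closed)
  then show "negligible (S - interior S)" using negligible_convex_frontier[OF assms(2)] by simp
qed (use assms(1) in simp)

lemma L2_on_diff:
  assumes "null_boundary S" "u \<in> L2_on S" "v \<in> L2_on S"
  shows "u - v \<in> L2_on S"
  using assms by (intro subspace_diff subspace_L2_on) (simp_all add: null_boundary_def)

text \<open>Two weak gradients in \<open>L2_on S\<close> differ by an element orthogonal to every
  test field, hence by 0, so the description is met by exactly one field. This lemma and its two
  analogues for curl and divergence are how the operators are evaluated.\<close>

lemma wgrad_eqI:
  assumes S: "null_boundary S" and g: "g \<in> L2_on S" "weak_grad (interior S) \<phi> g"
  shows "wgrad S \<phi> = g"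
  unfolding wgrad_def
proof (rule the_equality)
  fix g' assume g': "g' \<in> L2_on S \<and> weak_grad (interior S) \<phi> g'"
  have "g' - g = 0"
  proof (rule L2_on_eq_0_vector)
    show "g' - g \<in> L2_on S" using g g' by (intro L2_on_diff[OF S]) auto
    show "(g' - g) \<bullet> abs_L2 \<Psi> = 0" if "test_field (interior S) \<Psi>" for \<Psi>
      using that g(2) g' by (simp add: inner_diff_left weak_grad_iff)
  qed (use S in \<open>simp add: null_boundary_def\<close>)
  then show "g' = g" by simp
qed (use g in simp)

lemma wcurl_eqI:
  assumes S: "null_boundary S" and w: "w \<in> L2_on S" "weak_curl (interior S) u w"
  shows "wcurl S u = w"
  unfolding wcurl_def
proof (rule the_equality)
  fix w' assume w': "w' \<in> L2_on S \<and> weak_curl (interior S) u w'"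
  have "w' - w = 0"
  proof (rule L2_on_eq_0_vector)
    show "w' - w \<in> L2_on S" using w w' by (intro L2_on_diff[OF S]) auto
    show "(w' - w) \<bullet> abs_L2 \<Psi> = 0" if "test_field (interior S) \<Psi>" for \<Psi>
      using that w(2) w' by (simp add: inner_diff_left weak_curl_iff)
  qed (use S in \<open>simp add: null_boundary_def\<close>)
  then show "w' = w" by simp
qed (use w in simp)

lemma wdiv_eqI:
  assumes S: "null_boundary S" and d: "d \<in> L2_on S" "weak_div (interior S) u d"
  shows "wdiv S u = d"
  unfolding wdiv_def
proof (rule the_equality)
  fix d' assume d': "d' \<in> L2_on S \<and> weak_div (interior S) u d'"
  have "d' - d = 0"
  proof (rule L2_on_eq_0_scalar)
    show "d' - d \<in> L2_on S" using d d' by (intro L2_on_diff[OF S]) auto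
    show "(d' - d) \<bullet> abs_L2 \<psi> = 0" if "test_fun (interior S) \<psi>" for \<psi>
      using that d(2) d' by (simp add: inner_diff_left weak_div_iff)
  qed (use S in \<open>simp add: null_boundary_def\<close>)
  then show "d' = d" by simp
qed (use d in simp)

lemma H1_wgrad:
  assumes "null_boundary S" "\<phi> \<in> H1 S"
  shows "wgrad S \<phi> \<in> L2_on S" "weak_grad (interior S) \<phi> (wgrad S \<phi>)"
  using assms wgrad_eqI[OF assms(1)] unfolding H1_def by auto

lemma Hcurl_wcurl:
  assumes "null_boundary S" "u \<in> Hcurl S"
  shows "wcurl S u \<in> L2_on S" "weak_curl (interior S) u (wcurl S u)"
  using assms wcurl_eqI[OF assms(1)] unfolding Hcurl_def by auto

lemma Hdiv_wdiv:
  assumes "null_boundary S" "u \<in> Hdiv S"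
  shows "wdiv S u \<in> L2_on S" "weak_div (interior S) u (wdiv S u)"
  using assms wdiv_eqI[OF assms(1)] unfolding Hdiv_def by auto

section \<open>Curl of a gradient and gradient of a constant\<close>

lemma wcurl_wgrad:
  assumes S: "null_boundary S" and \<phi>: "\<phi> \<in> H1 S"
  shows "wcurl S (wgrad S \<phi>) = 0"
proof (rule wcurl_eqI[OF S])
  show "0 \<in> L2_on S" using S by (intro subspace_0 subspace_L2_on) (simp add: null_boundary_def)
  show "weak_curl (interior S) (wgrad S \<phi>) 0" by (rule weak_curl_grad[OF H1_wgrad(2)[OF S \<phi>]])
qed

lemma square_integrable_indicator_bounded:
  assumes "S \<in> sets lebesgue" "bounded S"
  shows "square_integrable (indicator S :: point \<Rightarrow> real)"
proof -
  have "integrable lebesgue (indicator S :: point \<Rightarrow> real)"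
    using bounded_set_imp_lmeasurable[OF assms(2,1)]
    by (intro integrable_real_indicator) (auto simp: fmeasurable_def)
  moreover have "(norm (indicator S x :: real))\<^sup>2 = indicator S x" for x :: point
    by (simp add: indicator_def)
  ultimately show ?thesis using assms by (simp add: square_integrable_def)
qed

lemma int_on_eq_ip:
  assumes "S \<in> sets lebesgue" "bounded S"
  shows "int_on S f = ip S (one_on S) f"
proof -
  have "ip S (one_on S) f = (LINT x|lebesgue. rep_L2 (restr S f) x \<bullet> indicator S x)"
    unfolding ip_eq_restr_right[OF assms(1)] one_on_def inner_commute[of "abs_L2 (indicator S)"]
    by (rule inner_abs_L2[OF square_integrable_indicator_bounded[OF assms]])
  also have "\<dots> = (LINT x|lebesgue. indicator S x *\<^sub>R rep_L2 f x)"
  proof (rule integral_cong_AE)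
    have m: "(indicator S :: point \<Rightarrow> real) \<in> borel_measurable lebesgue" using assms(1) by simp
    show "(\<lambda>x. rep_L2 (restr S f) x \<bullet> indicator S x) \<in> borel_measurable lebesgue"
      using m measurable_rep by (rule borel_measurable_inner[rotated])
    show "(\<lambda>x. indicator S x *\<^sub>R rep_L2 f x) \<in> borel_measurable lebesgue"
      using m measurable_rep by (rule borel_measurable_scaleR)
    show "AE x in lebesgue. rep_L2 (restr S f) x \<bullet> indicator S x = indicator S x *\<^sub>R rep_L2 f x"
      using rep_restr[OF assms(1), of f] by eventually_elim (simp add: indicator_def)
  qed
  finally show ?thesis by (simp add: int_on_def set_lebesgue_integral_def)
qed

text \<open>Testing the constant 1 leaves the integral of a classical divergence over the whole
  space, which vanishes by compact support. Boundedness of \<open>S\<close> makes the constant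
  square integrable. With this, the discrete Gauss law for the constant becomes a flux
  balance.\<close>

lemma wgrad_one_on:
  assumes S: "null_boundary S" "bounded S"
  shows "wgrad S (one_on S) = 0"
proof (rule wgrad_eqI[OF S(1)])
  have meas: "S \<in> sets lebesgue" using S by (simp add: null_boundary_def)
  show "0 \<in> L2_on S" by (intro subspace_0 subspace_L2_on meas)
  show "weak_grad (interior S) (one_on S) 0"
    unfolding weak_grad_iff
  proof (intro allI impI)
    fix \<Psi> assume \<Psi>: "test_field (interior S) \<Psi>"
    note div = test_fun_div[OF \<Psi>]
    have "one_on S \<bullet> abs_L2 (classical_div \<Psi>) = abs_L2 (classical_div \<Psi>) \<bullet> abs_L2 (indicator S)"
      by (simp add: one_on_def inner_commute)
    also have "\<dots> = int_on S (abs_L2 (classical_div \<Psi>))"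
      by (simp add: inner_abs_L2 square_integrable_indicator_bounded meas S int_on_def
          set_lebesgue_integral_def mult.commute)
    also have "\<dots> = (LINT x|lebesgue. classical_div \<Psi> x)"
      unfolding int_on_def set_lebesgue_integral_def
    proof (rule integral_cong_AE)
      show "(\<lambda>x. indicator S x *\<^sub>R rep_L2 (abs_L2 (classical_div \<Psi>)) x) \<in> borel_measurable lebesgue"
        using meas measurable_rep by (intro borel_measurable_scaleR) auto
      show "classical_div \<Psi> \<in> borel_measurable lebesgue"
        using square_integrable_test_fun[OF div] by (simp add: square_integrable_def)
      show "AE x in lebesgue. indicator S x *\<^sub>R rep_L2 (abs_L2 (classical_div \<Psi>)) x = classical_div \<Psi> x"
        using rep_abs_L2[OF square_integrable_test_fun[OF div]]
      proof eventually_elim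
        case (elim x)
        then show ?case
          using test_fun_eq_0[OF div, of x] interior_subset[of S] by (cases "x \<in> S") auto
      qed
    qed
    also have "\<dots> = (LINT x|lborel. classical_div \<Psi> x)"
      using test_fun_measurable[OF div] by (intro integral_completion) simp
    also have "\<dots> = (\<Sum>i\<in>UNIV. LINT x|lborel. partial i (\<lambda>y. \<Psi> y $ i) x)"
      unfolding classical_div_def
      using \<Psi> by (intro Bochner_Integration.integral_sum integrable_test_fun[of "interior S"] test_fun_partial)
        (simp add: test_field_def)
    also have "\<dots> = 0"
      using \<Psi> by (intro sum.neutral ballI integral_partial_eq_0[of "interior S"]) (simp add: test_field_def)
    finally show "0 \<bullet> abs_L2 \<Psi> = - (one_on S \<bullet> abs_L2 (classical_div \<Psi>))" by simp
  qed
qed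

text \<open>
  A triangulation only covers \<^term>\<open>closure \<Omega>\<close>; this is why the elements nevertheless have their
  interior in \<^term>\<open>\<Omega>\<close>, so that test functions on an element are test functions on \<^term>\<open>\<Omega>\<close>.
\<close>

lemma interior_closure_lipschitz:
  assumes \<Omega>: "open \<Omega>" "lipschitz_boundary \<Omega>"
  shows "interior (closure \<Omega>) = \<Omega>"
proof
  show "\<Omega> \<subseteq> interior (closure \<Omega>)" by (simp add: \<Omega>(1) closure_subset interior_maximal)
  show "interior (closure \<Omega>) \<subseteq> \<Omega>"
  proof
    fix x assume x: "x \<in> interior (closure \<Omega>)"
    show "x \<in> \<Omega>"
    proof (rule ccontr)
      assume xn: "x \<notin> \<Omega>"
      then have "x \<in> frontier \<Omega>"
        using x interior_subset[of "closure \<Omega>"] by (auto simp: frontier_def interior_open[OF \<Omega>(1)])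
      then obtain e r L \<gamma> where e: "norm e = 1" and r: "r > 0"
        and \<gamma>: "L-lipschitz_on {z. z \<bullet> e = 0} \<gamma>"
        and below: "\<And>y. y \<in> ball x r \<Longrightarrow> y \<in> \<Omega> \<longleftrightarrow> y \<bullet> e < \<gamma> (y - (y \<bullet> e) *\<^sub>R e)"
        using \<Omega>(2) unfolding lipschitz_boundary_def by metis
      let ?P = "\<lambda>y. y - (y \<bullet> e) *\<^sub>R e"
      have ee: "e \<bullet> e = 1" using e by (simp add: norm_eq_1)
      have P0: "?P y \<in> {z. z \<bullet> e = 0}" for y by (simp add: inner_diff_left ee)
      \<comment> \<open>On the closure the strict inequality that describes the region below the
        graph survives as a weak one, by continuity of \<gamma> on the hyperplane.\<close>
      have le: "z \<bullet> e \<le> \<gamma> (?P z)" if z: "z \<in> closure \<Omega>" "z \<in> ball x r" for z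
      proof -
        obtain w where w: "\<And>n. w n \<in> \<Omega>" "w \<longlonglongrightarrow> z" using z(1) closure_sequential by blast
        have lim: "(\<lambda>n. \<gamma> (?P (w n))) \<longlonglongrightarrow> \<gamma> (?P z)"
        proof (rule continuous_on_tendsto_compose[OF lipschitz_on_continuous_on[OF \<gamma>]])
          show "(\<lambda>n. ?P (w n)) \<longlonglongrightarrow> ?P z" by (intro tendsto_intros w)
        qed (use P0 in \<open>auto intro!: always_eventually\<close>)
        have "\<forall>\<^sub>F n in sequentially. w n \<in> ball x r"
          using w(2) z(2) by (intro topological_tendstoD) auto
        then have ev: "\<forall>\<^sub>F n in sequentially. w n \<bullet> e \<le> \<gamma> (?P (w n))"
          by eventually_elim (use below w(1) in \<open>auto intro: less_imp_le\<close>)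
        show ?thesis
          by (rule tendsto_le[OF _ lim _ ev]) (auto intro!: tendsto_intros w)
      qed
      obtain \<delta> where \<delta>: "\<delta> > 0" "ball x \<delta> \<subseteq> closure \<Omega>"
        using x by (auto simp: mem_interior)
      \<comment> \<open>Moving x by \<open>s\<close> in direction \<open>e\<close> keeps its
        projection to the hyperplane and raises its height. The moved point is still in the closure
        and in the chart, hence not above the graph, while x, not being in \<Omega>, is not below
        it. The half keeps \<open>s\<close> strictly under both radii.\<close>
      define s where "s = min \<delta> r / 2"
      have s: "0 < s" "s < \<delta>" "s < r" using \<delta> r by (auto simp: s_def min_def)
      let ?y = "x + s *\<^sub>R e"
      have "dist x ?y = s" using s e by (simp add: dist_norm)
      then have "?y \<in> closure \<Omega>" "?y \<in> ball x r" using s \<delta> by auto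
      from le[OF this] have "x \<bullet> e + s \<le> \<gamma> (?P x)"
        by (simp add: inner_add_left ee algebra_simps)
      moreover have "\<gamma> (?P x) \<le> x \<bullet> e" using below[of x] xn r by auto
      ultimately show False using s by simp
    qed
  qed
qed

section \<open>Curves in time\<close>

lemma has_vector_derivative_0_imp_eq:
  assumes "is_interval I" "s \<in> I" "t \<in> I"
    and "\<And>r. r \<in> I \<Longrightarrow> (f has_vector_derivative 0) (at r within I)"
  shows "f t = f s"
  using has_vector_derivative_zero_constant[of I f] assms is_interval_convex by metis

lemma C1_curve_inner:
  assumes "C1_curve I f f'" "t \<in> I"
  shows "((\<lambda>t. f t \<bullet> v) has_vector_derivative f' t \<bullet> v) (at t within I)"
  using assms unfolding C1_curve_def
  by (intro bounded_linear.has_vector_derivative[OF bounded_linear_inner_left]) blast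

section \<open>Conservation of the discrete Gauss law\<close>

theorem theorem4p2:
  fixes \<Omega> :: "point set" and \<T> :: "point set set"
    and I :: "real set" and t0 :: real
    and \<epsilon> \<mu> :: "real \<Rightarrow> point \<Rightarrow> real^3^3"
    and J :: "real \<Rightarrow> (real^3) L2" and \<rho> \<rho>' :: "real \<Rightarrow> real L2"
    and V1 :: "point set \<Rightarrow> (real^3) L2 set" and Vhat :: "(real^3) L2 set"
    and V0 :: "point set \<Rightarrow> real L2 set"
    and A A' E B D D' H Hhat Dhat Dhat' :: "real \<Rightarrow> (real^3) L2"
  assumes domain: "polyhedral_lipschitz_domain \<Omega>" and mesh: "tetrahedral_mesh \<Omega> \<T>"
    and time: "is_interval I" "t0 \<in> I"
    and tensors: "elliptic_tensor \<Omega> I \<epsilon>" "elliptic_tensor \<Omega> I \<mu>"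
    and J: "C0_curve_Hdiv \<Omega> I J"
    and \<rho>: "\<And>t. t \<in> I \<Longrightarrow> \<rho> t \<in> L2_on \<Omega>" "C1_curve I \<rho> \<rho>'"
    and charge_conservation: "\<And>t. t \<in> I \<Longrightarrow> \<rho>' t + wdiv \<Omega> (J t) = 0"
    and V1: "\<And>K. K \<in> \<T> \<Longrightarrow> V1 K \<subseteq> Hcurl K"
      "\<And>K. K \<in> \<T> \<Longrightarrow> \<exists>\<B>. finite \<B> \<and> V1 K = span \<B>"
    and Vhat: "subspace Vhat" "Vhat \<subseteq> Hcurl \<Omega>"
    and V0: "\<And>K. K \<in> \<T> \<Longrightarrow> subspace (V0 K)" "\<And>K. K \<in> \<T> \<Longrightarrow> V0 K \<subseteq> H1 K"
      "\<And>K. K \<in> \<T> \<Longrightarrow> one_on K \<in> V0 K" "\<And>K. K \<in> \<T> \<Longrightarrow> wgrad K ` V0 K \<subseteq> V1 K"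
    and A: "\<And>t. t \<in> I \<Longrightarrow> A t \<in> product_space \<Omega> \<T> V1" "C1_curve I A A'"
    and Hhat: "\<And>t. t \<in> I \<Longrightarrow> Hhat t \<in> Vhat" "C0_curve_Hcurl \<Omega> I Hhat"
    and E: "\<And>t. t \<in> I \<Longrightarrow> E t = - A' t"
    and B: "\<And>t. t \<in> I \<Longrightarrow> B t = broken_curl \<T> (A t)"
    and D: "\<And>t. t \<in> I \<Longrightarrow> D t = mult_field (\<epsilon> t) (E t)" "C1_curve I D D'"
    and H: "\<And>t. t \<in> I \<Longrightarrow> H t = mult_field (\<lambda>x. matrix_inv (\<mu> t x)) (B t)"
    and method1: "\<And>t K a. t \<in> I \<Longrightarrow> K \<in> \<T> \<Longrightarrow> a \<in> V1 K \<Longrightarrow>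
      ip K a (D' t + J t) - ip K (wcurl K a) (H t) + bd_cross K a (restr K (Hhat t)) = 0"
    and method2: "\<And>t h. t \<in> I \<Longrightarrow> h \<in> Vhat \<Longrightarrow>
      (\<Sum>K\<in>\<T>. bd_cross K (restr K (A t)) (restr K h)) = 0"
    and Dhat_init: "Dhat t0 \<in> Hdiv \<Omega>"
    and Dhat: "\<And>t. t \<in> I \<Longrightarrow> Dhat t \<in> L2_on \<Omega>" "C1_curve I Dhat Dhat'"
      "\<And>t. t \<in> I \<Longrightarrow> Dhat' t + J t = wcurl \<Omega> (Hhat t)"
    and gauss_init: "\<And>K. K \<in> \<T> \<Longrightarrow> discrete_gauss K (V0 K) (D t0) (\<rho> t0) (Dhat t0)"
  shows "(\<forall>t\<in>I. Dhat t \<in> Hdiv \<Omega>) \<and>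
    (\<forall>t\<in>I. \<forall>K\<in>\<T>. discrete_gauss K (V0 K) (D t) (\<rho> t) (Dhat t)) \<and>
    (\<forall>t\<in>I. \<forall>K\<in>\<T>. bd_flux K (one_on K) (restr K (Dhat t)) = int_on K (\<rho> t)) \<and>
    (wdiv \<Omega> (Dhat t0) = \<rho> t0 \<longrightarrow> (\<forall>t\<in>I. wdiv \<Omega> (Dhat t) = \<rho> t))"
proof -
  have \<Omega>: "open \<Omega>" "lipschitz_boundary \<Omega>"
    using domain by (auto simp: polyhedral_lipschitz_domain_def)
  note nb\<Omega> = null_boundary_open[OF \<Omega>(1)]
  have int\<Omega>: "interior \<Omega> = \<Omega>" by (rule interior_open[OF \<Omega>(1)])
  have nbK: "null_boundary K" and bK: "bounded K" and intK: "interior K \<subseteq> \<Omega>" if K: "K \<in> \<T>" for K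
  proof -
    have simp: "3 simplex K" and sub: "K \<subseteq> closure \<Omega>"
      using mesh K by (auto simp: tetrahedral_mesh_def)
    show "null_boundary K"
      by (rule null_boundary_closed_convex[OF closed_simplex[OF simp] convex_simplex[OF simp]])
    show "bounded K" by (rule compact_imp_bounded[OF compact_simplex[OF simp]])
    show "interior K \<subseteq> \<Omega>"
      using interior_mono[OF sub] interior_closure_lipschitz[OF \<Omega>] by simp
  qed
  have mK: "K \<in> sets lebesgue" if "K \<in> \<T>" for K
    using nbK[OF that] by (simp add: null_boundary_def)
  \<comment> \<open>The expected divergence of \<open>Dhat t\<close>: formally its time derivative
    is - div J, which is \<open>\<rho>'\<close> by charge conservation, and integration from
    \<open>t0\<close> gives this expression.\<close>
  define d where "d t = wdiv \<Omega> (Dhat t0) + \<rho> t - \<rho> t0" for t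
  have d_L2: "d t \<in> L2_on \<Omega>" if "t \<in> I" for t
    using Hdiv_wdiv(1)[OF nb\<Omega> Dhat_init] \<rho>(1) time(2) that nb\<Omega> unfolding d_def
    by (intro subspace_diff subspace_add subspace_L2_on) (auto simp: null_boundary_def)
  have Hcurl_H: "Hhat t \<in> Hcurl \<Omega>" if "t \<in> I" for t using Hhat(1) Vhat(2) that by blast
  have d_div: "weak_div \<Omega> (Dhat t) (d t)" if t: "t \<in> I" for t
    unfolding weak_div_iff
  proof (intro allI impI)
    fix \<psi> assume \<psi>: "test_fun \<Omega> \<psi>"
    let ?g = "abs_L2 (classical_grad \<psi>)" and ?\<psi> = "abs_L2 \<psi>"
    have "Dhat t \<bullet> ?g + \<rho> t \<bullet> ?\<psi> = Dhat t0 \<bullet> ?g + \<rho> t0 \<bullet> ?\<psi>"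
    proof (rule has_vector_derivative_0_imp_eq[OF time t])
      fix r assume r: "r \<in> I"
      have "wcurl \<Omega> (Hhat r) \<bullet> ?g = 0"
        using weak_div_curl[OF Hcurl_wcurl(2)[OF nb\<Omega> Hcurl_H[OF r]]] \<psi>
        by (simp add: weak_div_iff int\<Omega>)
      moreover have "wdiv \<Omega> (J r) \<bullet> ?\<psi> = - (J r \<bullet> ?g)"
        using Hdiv_wdiv(2)[OF nb\<Omega>, of "J r"] J r \<psi>
        by (simp add: weak_div_iff int\<Omega> C0_curve_Hdiv_def)
      moreover have "Dhat' r = wcurl \<Omega> (Hhat r) - J r" "\<rho>' r = - wdiv \<Omega> (J r)"
        using Dhat(3)[OF r] charge_conservation[OF r] by (simp_all add: algebra_simps eq_neg_iff_add_eq_0)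
      ultimately have "Dhat' r \<bullet> ?g + \<rho>' r \<bullet> ?\<psi> = 0"
        by (simp add: inner_diff_left)
      then show "((\<lambda>t. Dhat t \<bullet> ?g + \<rho> t \<bullet> ?\<psi>) has_vector_derivative 0) (at r within I)"
        using has_vector_derivative_add[OF C1_curve_inner[OF Dhat(2) r] C1_curve_inner[OF \<rho>(2) r], of ?g ?\<psi>]
        by simp
    qed
    moreover have "wdiv \<Omega> (Dhat t0) \<bullet> ?\<psi> = - (Dhat t0 \<bullet> ?g)"
      using Hdiv_wdiv(2)[OF nb\<Omega> Dhat_init] \<psi> by (simp add: weak_div_iff int\<Omega>)
    ultimately show "d t \<bullet> ?\<psi> = - (Dhat t \<bullet> ?g)"
      by (simp add: d_def inner_add_left inner_diff_left)
  qed
  have wdiv_Dhat: "wdiv \<Omega> (Dhat t) = d t" if "t \<in> I" for t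
    using wdiv_eqI[OF nb\<Omega> d_L2[OF that]] d_div[OF that] by (simp add: int\<Omega>)
  have Hdiv: "Dhat t \<in> Hdiv \<Omega>" if "t \<in> I" for t
    using Dhat(1) d_L2 d_div that unfolding Hdiv_def int\<Omega> by blast
  have wdiv_restr: "wdiv K (restr K (Dhat t)) = restr K (d t)" if "t \<in> I" "K \<in> \<T>" for t K
    by (intro wdiv_eqI nbK restr_in_L2_on mK weak_div_restr[OF _ intK d_div] that)
  \<comment> \<open>Because \<open>Hhat t\<close> has a global curl, its curl on an element is the
    restriction of that field. This turns the boundary term of the method into a volume pairing with
    \<open>Dhat' + J\<close>.\<close>
  have wcurl_restr: "wcurl K (restr K (Hhat t)) = restr K (Dhat' t + J t)" if "t \<in> I" "K \<in> \<T>" for t K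
  proof -
    have "weak_curl \<Omega> (Hhat t) (Dhat' t + J t)"
      using Hcurl_wcurl(2)[OF nb\<Omega> Hcurl_H] Dhat(3) that by (simp add: int\<Omega>)
    then show ?thesis
      by (intro wcurl_eqI nbK restr_in_L2_on mK weak_curl_restr[OF _ intK] that)
  qed
  have restr2: "restr K (restr K u) = restr K u" if "K \<in> \<T>" for K and u :: "'b::euclidean_space L2"
    using restr_in_L2_on[OF mK[OF that]] L2_on_iff_restr[OF mK[OF that]] by blast
  have gauss: "discrete_gauss K (V0 K) (D t) (\<rho> t) (Dhat t)" if t: "t \<in> I" and K: "K \<in> \<T>" for t K
    unfolding discrete_gauss_def
  proof
    fix \<phi> assume \<phi>: "\<phi> \<in> V0 K"
    let ?g = "wgrad K \<phi>"
    let ?F = "\<lambda>t. ip K ?g (D t) + ip K \<phi> (\<rho> t) - bd_flux K \<phi> (restr K (Dhat t))"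
    have \<phi>H1: "\<phi> \<in> H1 K" using V0(2)[OF K] \<phi> by blast
    have ip_swap: "ip K u v = v \<bullet> restr K u" for u v :: "'b::euclidean_space L2"
      by (subst ip_commute) (rule ip_eq_restr_right[OF mK[OF K]])
    have inner_restr: "restr K v \<bullet> restr K u = v \<bullet> restr K u" for u v :: "'b::euclidean_space L2"
      using ip_eq_restr_right[OF mK[OF K], of u "restr K v"] ip_eq_restr_right[OF mK[OF K], of u v]
      by (simp add: ip_swap restr2[OF K])
    \<comment> \<open>By definition the flux contains the pairing of \<phi> with the divergence
      \<open>d s\<close>, whose summand \<open>\<rho> s\<close> cancels the charge term. The last
      term that remains does not depend on \<open>s\<close>.\<close>
    have F: "?F s = D s \<bullet> restr K ?g - Dhat s \<bullet> restr K ?g - (wdiv \<Omega> (Dhat t0) - \<rho> t0) \<bullet> restr K \<phi>"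
      if "s \<in> I" for s
      by (simp add: bd_flux_def wdiv_restr[OF that K] ip_swap inner_restr d_def inner_diff_left inner_add_left)
    have "?F t = ?F t0"
      unfolding F[OF t] F[OF time(2)]
    proof -
      have "D t \<bullet> restr K ?g - Dhat t \<bullet> restr K ?g = D t0 \<bullet> restr K ?g - Dhat t0 \<bullet> restr K ?g"
      proof (rule has_vector_derivative_0_imp_eq[OF time t])
        fix r assume r: "r \<in> I"
        have "?g \<in> V1 K" using V0(4)[OF K] \<phi> by blast
        from method1[OF r K this]
        \<comment> \<open>Since the curl of \<open>?g\<close> vanishes, both the \<open>H\<close>
          term and the first half of the boundary term drop out; the other half contributes the curl
          of \<open>Hhat\<close>. In the identity that results, \<open>J\<close> stands on both
          sides.\<close>
        have "ip K ?g (D' r + J r) - ip K ?g (restr K (Dhat' r + J r)) = 0"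
          by (simp add: bd_cross_def wcurl_wgrad[OF nbK[OF K] \<phi>H1] wcurl_restr[OF r K] ip_zero_left[OF mK[OF K]])
        then have "(D' r + J r) \<bullet> restr K ?g = (Dhat' r + J r) \<bullet> restr K ?g"
          by (simp add: ip_swap inner_restr)
        then have "D' r \<bullet> restr K ?g - Dhat' r \<bullet> restr K ?g = 0"
          by (simp add: inner_add_left)
        then show "((\<lambda>t. D t \<bullet> restr K ?g - Dhat t \<bullet> restr K ?g) has_vector_derivative 0) (at r within I)"
          using has_vector_derivative_diff[OF C1_curve_inner[OF D(2) r] C1_curve_inner[OF Dhat(2) r],
              of "restr K ?g" "restr K ?g"]
          by simp
      qed
      then show "D t \<bullet> restr K ?g - Dhat t \<bullet> restr K ?g - (wdiv \<Omega> (Dhat t0) - \<rho> t0) \<bullet> restr K \<phi> =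
        D t0 \<bullet> restr K ?g - Dhat t0 \<bullet> restr K ?g - (wdiv \<Omega> (Dhat t0) - \<rho> t0) \<bullet> restr K \<phi>"
        by simp
    qed
    also have "?F t0 = 0"
      using gauss_init[OF K] \<phi> by (simp add: discrete_gauss_def)
    finally show "?F t = 0" .
  qed
  have "bd_flux K (one_on K) (restr K (Dhat t)) = int_on K (\<rho> t)" if t: "t \<in> I" and K: "K \<in> \<T>" for t K
  proof -
    \<comment> \<open>The Gauss law is evaluated at the constant 1, whose gradient 0 removes
      \<open>D t\<close>.\<close>
    have "ip K 0 (D t) + ip K (one_on K) (\<rho> t) - bd_flux K (one_on K) (restr K (Dhat t)) = 0"
      using gauss[OF t K] V0(3)[OF K] wgrad_one_on[OF nbK[OF K] bK[OF K]]
      by (auto simp: discrete_gauss_def)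
    then show ?thesis
      by (simp add: int_on_eq_ip[OF mK[OF K] bK[OF K]] ip_zero_left[OF mK[OF K]])
  qed
  moreover have "wdiv \<Omega> (Dhat t) = \<rho> t" if "wdiv \<Omega> (Dhat t0) = \<rho> t0" "t \<in> I" for t
    using wdiv_Dhat[OF that(2)] that(1) by (simp add: d_def)
  ultimately show ?thesis using Hdiv gauss by blast
qed

end
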